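(* Let $X$ be a compact metric space and let $G$ be a discrete countable amenable group acting on $X$ by homeomorphisms. Then for any tempered Følner sequence $\{F_n\}$ in $G$ satisfying $$\lim_{n\to+\infty}\frac{|F_n|}{\log n}=\infty,$$ we have $$h^B_{top}(X,\{F_n\})=h_{top}(X,G),$$ where $h^B_{top}(X,\{F_n\})$ is the Bowen topological entropy of the whole space $X$ with respect to $\{F_n\}$ and $h_{top}(X,G)$ is the topological entropy of the action.
   Context: Følner sequence: a sequence $\{F_n\}_{n\ge 1}$ of (non-empty) finite subsets of $G$ with $\lim_{n\to+\infty}\frac{|F_n\vartriangle gF_n|}{|F_n|}=0$ for all $g\in G$. It is tempered if there is a constant $C$, independent of $n$, such that $\left|\bigcup_{k<n}F_k^{-1}F_n\right|\le C|F_n|$ for every $n$. Topological entropy: for an open cover $\mathcal{U}$ of $X$ and a finite set $F\subset G$ put $\mathcal{U}_F=\bigvee_{g\in F}g^{-1}\mathcal{U}$, and let $N(\mathcal{V})$ denote the minimal cardinality of a subcover of an open cover $\mathcal{V}$. Then $h_{top}(G,\mathcal{U})=\lim_{n\to+\infty}\frac{1}{|F_n|}\log N(\mathcal{U}_{F_n})$ (this does not depend on the choice of Følner sequence $\{F_n\}$), and $h_{top}(X,G)=\sup_{\mathcal{U}}h_{top}(G,\mathcal{U})$ over all open covers $\mathcal{U}$ of $X$. Bowen topological entropy: let $\mathcal{U}$ be a finite open cover of $X$. For $n\ge1$ let $\mathcal{W}_{F_n}(\mathcal{U})$ be the collection of families $\mathbf{U}=\{U_g\}_{g\in F_n}$ with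 $U_g\in\mathcal{U}$; for such $\mathbf{U}$ put $m(\mathbf{U})=|F_n|$ and $X(\mathbf{U})=\bigcap_{g\in F_n}g^{-1}U_g=\{x\in X: gx\in U_g \text{ for } g\in F_n\}$. For $Z\subset X$, a set $\Lambda\subset\bigcup_{n\ge1}\mathcal{W}_{F_n}(\mathcal{U})$ covers $Z$ if $\bigcup_{\mathbf{U}\in\Lambda}X(\mathbf{U})\supset Z$. For $s\in\mathbb{R}$ and $N\in\mathbb{N}$ let $$\mathcal{M}(Z,\mathcal{U},N,s,\{F_n\})=\inf_\Lambda\sum_{\mathbf{U}\in\Lambda}\exp(-s\,m(\mathbf{U})),$$ the infimum being over all $\Lambda\subset\bigcup_{j\ge N}\mathcal{W}_{F_j}(\mathcal{U})$ that cover $Z$. Let $\mathcal{M}(Z,\mathcal{U},s,\{F_n\})=\lim_{N\to+\infty}\mathcal{M}(Z,\mathcal{U},N,s,\{F_n\})$ and $$h^B_{top}(\mathcal{U},Z,\{F_n\})=\inf\{s:\mathcal{M}(Z,\mathcal{U},s,\{F_n\})=0\}=\sup\{s:\mathcal{M}(Z,\mathcal{U},s,\{F_n\})=+\infty\}.$$ Finally $h^B_{top}(Z,\{F_n\})=\sup_{\mathcal{U}}h^B_{top}(\mathcal{U},Z,\{F_n\})$, where $\mathcal{U}$ runs over finite open covers of $X$. The paper also uses the following equivalent definition. Let $d$ be the metric on $X$ and, for finite $F\subset G$, $B_F(x,\epsilon)=\{y\in X: d(gx,gy)<\epsilon \text{ for all } g\in F\}$. For $Z\subseteq X$, $s\ge0$,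 $N\in\mathbb{N}$, $\epsilon>0$ let $\mathcal{M}(Z,N,\epsilon,s,\{F_n\})=\inf\sum_i\exp(-s|F_{n_i}|)$ over all finite or countable families $\{B_{F_{n_i}}(x_i,\epsilon)\}$ with $x_i\in X$, $n_i\ge N$ and $\bigcup_iB_{F_{n_i}}(x_i,\epsilon)\supseteq Z$. Let $\mathcal{M}(Z,s,\{F_n\})=\lim_{\epsilon\to0}\lim_{N\to+\infty}\mathcal{M}(Z,N,\epsilon,s,\{F_n\})$. Then $h^B_{top}(Z,\{F_n\})$ is the critical value of $s$ at which $\mathcal{M}(Z,s,\{F_n\})$ jumps from $+\infty$ to $0$. *)

theory Defs
  imports "HOL-Analysis.Analysis" "HOL-Algebra.Group_Action"
begin

text \<open>Sequences of finite subsets of a group are indexed by \<open>n \<ge> 1\<close>: the value at \<open>0\<close> of the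
  representing function is ignored throughout.  The compact metric space acted upon is the
  universe of a metric type.\<close>


section \<open>Amenability and Foelner sequences\<close>

text \<open>Amenability of a discrete group: existence of a left-invariant finitely additive
  probability measure on all of its subsets.\<close>

definition amenable :: "('g, 'm) monoid_scheme \<Rightarrow> bool" where
  "amenable G \<longleftrightarrow>
    (\<exists>\<mu> :: 'g set \<Rightarrow> real.
      \<mu> (carrier G) = 1 \<and>
      (\<forall>A. A \<subseteq> carrier G \<longrightarrow> 0 \<le> \<mu> A) \<and>
      (\<forall>A B. A \<subseteq> carrier G \<longrightarrow> B \<subseteq> carrier G \<longrightarrow> A \<inter> B = {} \<longrightarrow> \<mu> (A \<union> B) = \<mu> A + \<mu> B) \<and>
      (\<forall>g\<in>carrier G. \<forall>A. A \<subseteq> carrier G \<longrightarrow> \<mu> (g <#\<^bsub>G\<^esub> A) = \<mu> A))"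

definition folner_seq :: "('g, 'm) monoid_scheme \<Rightarrow> (nat \<Rightarrow> 'g set) \<Rightarrow> bool" where
  "folner_seq G F \<longleftrightarrow>
    (\<forall>n\<ge>1. finite (F n) \<and> F n \<noteq> {} \<and> F n \<subseteq> carrier G) \<and>
    (\<forall>g\<in>carrier G.
      (\<lambda>n. real (card (sym_diff (F n) (g <#\<^bsub>G\<^esub> F n))) / real (card (F n))) \<longlonglongrightarrow> 0)"

definition tempered :: "('g, 'm) monoid_scheme \<Rightarrow> (nat \<Rightarrow> 'g set) \<Rightarrow> bool" where
  "tempered G F \<longleftrightarrow>
    (\<exists>C::real. \<forall>n\<ge>1.
      real (card (\<Union>k\<in>{1..<n}. (set_inv\<^bsub>G\<^esub> (F k)) <#>\<^bsub>G\<^esub> F n)) \<le> C * real (card (F n)))"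


section \<open>Topological entropy\<close>

definition open_cover :: "'x::topological_space set set \<Rightarrow> bool" where
  "open_cover \<U> \<longleftrightarrow> (\<forall>U\<in>\<U>. open U) \<and> \<Union>\<U> = UNIV"

text \<open>The join of the covers \<open>g\<^sup>-\<^sup>1\<U>\<close> for \<open>g \<in> F\<close>.\<close>

definition cover_join :: "('g \<Rightarrow> 'x \<Rightarrow> 'x) \<Rightarrow> 'x set set \<Rightarrow> 'g set \<Rightarrow> 'x set set" where
  "cover_join \<phi> \<U> F = {(\<Inter>g\<in>F. \<phi> g -` V g) | V. \<forall>g\<in>F. V g \<in> \<U>}"

text \<open>Only finite subcovers compete, so that infinite sets (whose \<^const>\<open>card\<close> is \<open>0\<close>) are
  excluded; on a compact space every open cover has a finite subcover.\<close>

definition cover_number :: "'x set set \<Rightarrow> nat" where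
  "cover_number \<V> = (LEAST n. \<exists>\<W>\<subseteq>\<V>. finite \<W> \<and> \<Union>\<W> = UNIV \<and> card \<W> = n)"

text \<open>The limit along a Foelner sequence exists and does not depend on that sequence;
  the entropy of a cover is this common limit.\<close>

definition cover_entropy ::
    "('g, 'm) monoid_scheme \<Rightarrow> ('g \<Rightarrow> 'x \<Rightarrow> 'x) \<Rightarrow> 'x set set \<Rightarrow> real" where
  "cover_entropy G \<phi> \<U> =
    (THE h. \<forall>F. folner_seq G F \<longrightarrow>
      (\<lambda>n. ln (real (cover_number (cover_join \<phi> \<U> (F n)))) / real (card (F n))) \<longlonglongrightarrow> h)"

definition top_entropy ::
    "('g, 'm) monoid_scheme \<Rightarrow> ('g \<Rightarrow> 'x::topological_space \<Rightarrow> 'x) \<Rightarrow> ereal" where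
  "top_entropy G \<phi> = (SUP \<U>\<in>{\<U>. open_cover \<U>}. ereal (cover_entropy G \<phi> \<U>))"


section \<open>Bowen topological entropy\<close>

text \<open>A family \<open>(U\<^sub>g)\<close> indexed by a finite set \<open>E\<close> is a partial map with domain \<open>E\<close>, so that the
  index set, and hence \<open>m(u) = card (dom u)\<close>, can be read off from the family.\<close>

definition families :: "'x set set \<Rightarrow> 'g set \<Rightarrow> ('g \<rightharpoonup> 'x set) set" where
  "families \<U> E = {u. dom u = E \<and> ran u \<subseteq> \<U>}"

definition family_set :: "('g \<Rightarrow> 'x \<Rightarrow> 'x) \<Rightarrow> ('g \<rightharpoonup> 'x set) \<Rightarrow> 'x set" where
  "family_set \<phi> u = (\<Inter>g\<in>dom u. \<phi> g -` the (u g))"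

definition bowen_M_N ::
    "('g \<Rightarrow> 'x \<Rightarrow> 'x) \<Rightarrow> (nat \<Rightarrow> 'g set) \<Rightarrow> 'x set \<Rightarrow> 'x set set \<Rightarrow> nat \<Rightarrow> real \<Rightarrow> ennreal" where
  "bowen_M_N \<phi> F Z \<U> N s =
    (INF \<Lambda>\<in>{\<Lambda>. \<Lambda> \<subseteq> (\<Union>j\<in>{j. 1 \<le> j \<and> N \<le> j}. families \<U> (F j)) \<and>
                Z \<subseteq> (\<Union>u\<in>\<Lambda>. family_set \<phi> u)}.
      (\<Sum>\<^sub>\<infinity>u\<in>\<Lambda>. ennreal (exp (- s * real (card (dom u))))))"

definition bowen_M ::
    "('g \<Rightarrow> 'x \<Rightarrow> 'x) \<Rightarrow> (nat \<Rightarrow> 'g set) \<Rightarrow> 'x set \<Rightarrow> 'x set set \<Rightarrow> real \<Rightarrow> ennreal" where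
  "bowen_M \<phi> F Z \<U> s = lim (\<lambda>N. bowen_M_N \<phi> F Z \<U> N s)"

definition bowen_cover_entropy ::
    "('g \<Rightarrow> 'x \<Rightarrow> 'x) \<Rightarrow> (nat \<Rightarrow> 'g set) \<Rightarrow> 'x set \<Rightarrow> 'x set set \<Rightarrow> ereal" where
  "bowen_cover_entropy \<phi> F Z \<U> = Inf (ereal ` {s. bowen_M \<phi> F Z \<U> s = 0})"

definition bowen_entropy ::
    "('g \<Rightarrow> 'x::topological_space \<Rightarrow> 'x) \<Rightarrow> (nat \<Rightarrow> 'g set) \<Rightarrow> 'x set \<Rightarrow> ereal" where
  "bowen_entropy \<phi> F Z =
    (SUP \<U>\<in>{\<U>. finite \<U> \<and> open_cover \<U>}. bowen_cover_entropy \<phi> F Z \<U>)"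

end

theory Submission
  imports Defs
begin

text \<open>Everything reduces to one covering estimate: if \<open>M(X, \<U>, s) = 0\<close> along a tempered sequence
  \<open>F\<close>, then \<open>ln N(\<U>\<^sub>E) \<le> (s + \<delta>)|E|\<close> for every sufficiently invariant finite set \<open>E\<close>.  By
  compactness there is a finite Bowen cover \<open>\<Lambda>\<close> of arbitrarily small total weight.  A point \<open>x\<close>
  assigns to each \<open>c \<in> E\<close> a word of \<open>\<Lambda>\<close> containing \<open>c x\<close>, hence a tile \<open>F\<^sub>j c\<close>.  Choosing tiles
  greedily, larger \<open>j\<close> first, with overlaps of relative size at most \<open>\<epsilon>\<close>, covers a fixed proportion
  of \<open>E\<close>, because temperedness bounds the number of small tiles meeting a given large one.  The weights
  \<open>exp (- s m(u))\<close>, summed over all configurations of tiles, contribute at most \<open>exp (\<tau>|E|)\<close>.  The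
  uncovered part is again nearly invariant under smaller tiles, so the step can be iterated until a
  negligible proportion is left.

  Conversely, \<open>ln N(\<U>\<^sub>F\<^sub>n) \<le> b|F\<^sub>n|\<close> for infinitely many \<open>n\<close> makes \<open>M(X, \<U>, s)\<close> vanish for \<open>s > b\<close>.
  Since every Foelner sequence has a tempered subsequence, the two facts show together that
  \<open>ln N(\<U>\<^sub>F\<^sub>n) / |F\<^sub>n|\<close> has the same limit along all Foelner sequences, and that this limit is the Bowen
  entropy of \<open>\<U>\<close>.  The growth condition only serves to exclude finite groups.\<close>

section \<open>Boundaries and quasi-tilings\<close>

text \<open>Two-sided boundary: for \<open>D\<close> inside the carrier, \<open>E\<close> and
  \<open>carrier G - E\<close> have the same one, so boundaries merely add up under unions and
  differences. \<open>D\<close> acts on the left because tiles will be right translates.\<close>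

definition boundary :: "('g, 'm) monoid_scheme \<Rightarrow> 'g set \<Rightarrow> 'g set \<Rightarrow> 'g set" where
  "boundary G D E = {c \<in> carrier G. \<exists>g\<in>D. (c \<in> E) \<noteq> (g \<otimes>\<^bsub>G\<^esub> c \<in> E)}"

lemma boundary_Diff_subset: "boundary G D (A - B) \<subseteq> boundary G D A \<union> boundary G D B"
  by (auto simp: boundary_def)

lemma boundary_UN_subset: "boundary G D (\<Union>i\<in>I. A i) \<subseteq> (\<Union>i\<in>I. boundary G D (A i))"
  by (auto simp: boundary_def)

lemma boundary_mono: "D \<subseteq> D' \<Longrightarrow> boundary G D E \<subseteq> boundary G D' E"
  by (auto simp: boundary_def)

context group
begin

lemma in_l_coset_iff:
  assumes "E \<subseteq> carrier G" "g \<in> carrier G" "c \<in> carrier G"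
  shows "c \<in> g <#\<^bsub>G\<^esub> E \<longleftrightarrow> inv g \<otimes> c \<in> E"
proof
  assume "c \<in> g <#\<^bsub>G\<^esub> E"
  then obtain e where "e \<in> E" "c = g \<otimes> e" by (auto simp: l_coset_def)
  then show "inv g \<otimes> c \<in> E"
    using assms by (simp add: m_assoc[symmetric] subset_iff)
next
  assume "inv g \<otimes> c \<in> E"
  moreover have "c = g \<otimes> (inv g \<otimes> c)"
    using assms by (simp add: m_assoc[symmetric])
  ultimately show "c \<in> g <#\<^bsub>G\<^esub> E" by (auto simp: l_coset_def)
qed

lemma l_coset_closed: "E \<subseteq> carrier G \<Longrightarrow> g \<in> carrier G \<Longrightarrow> g <#\<^bsub>G\<^esub> E \<subseteq> carrier G"
  by (auto simp: l_coset_def)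

lemma finite_l_coset: "finite E \<Longrightarrow> finite (g <#\<^bsub>G\<^esub> E)"
  by (auto simp: l_coset_def)

text \<open>That \<open>g \<otimes> c\<close> lies in \<open>E\<close> means that \<open>c\<close>
  lies in the left coset of \<open>E\<close> by \<open>inv g\<close>; this links boundaries with
  \<open>folner_seq\<close>.\<close>

lemma boundary_eq_UN_sym_diff:
  assumes "D \<subseteq> carrier G" "E \<subseteq> carrier G"
  shows "boundary G D E = (\<Union>g\<in>D. sym_diff E (inv g <#\<^bsub>G\<^esub> E))"
proof (rule Set.set_eqI)
  fix c
  have *: "(c \<in> E) \<noteq> (g \<otimes> c \<in> E) \<longleftrightarrow> c \<in> sym_diff E (inv g <#\<^bsub>G\<^esub> E)"
    if "g \<in> D" "c \<in> carrier G" for g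
    using that assms in_l_coset_iff[of E "inv g" c] by (auto simp: subset_iff)
  have "c \<notin> sym_diff E (inv g <#\<^bsub>G\<^esub> E)" if "g \<in> D" "c \<notin> carrier G" for g
    using that assms l_coset_closed[of E "inv g"] by (auto simp: subset_iff)
  then show "c \<in> boundary G D E \<longleftrightarrow> c \<in> (\<Union>g\<in>D. sym_diff E (inv g <#\<^bsub>G\<^esub> E))"
    unfolding boundary_def mem_Collect_eq UN_iff using * by meson
qed

lemma finite_boundary:
  assumes "D \<subseteq> carrier G" "E \<subseteq> carrier G" "finite D" "finite E"
  shows "finite (boundary G D E)"
  using assms by (simp add: boundary_eq_UN_sym_diff finite_l_coset)

text \<open>The boundary is a union of \<open>card D\<close> symmetric differences, each of
  vanishing relative size.\<close>

lemma folner_boundary: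
  assumes F: "folner_seq G F" and D: "finite D" "D \<subseteq> carrier G" and "\<eta> > 0"
  shows "\<forall>\<^sub>F n in sequentially. real (card (boundary G D (F n))) \<le> \<eta> * real (card (F n))"
proof -
  let ?r = "\<lambda>g n. real (card (sym_diff (F n) (g <#\<^bsub>G\<^esub> F n))) / real (card (F n))"
  have "(\<lambda>n. \<Sum>g\<in>D. ?r (inv g) n) \<longlonglongrightarrow> (\<Sum>g\<in>D. 0)"
    using F D by (intro tendsto_sum) (auto simp: folner_seq_def)
  then have "\<forall>\<^sub>F n in sequentially. (\<Sum>g\<in>D. ?r (inv g) n) < \<eta>"
    using \<open>\<eta> > 0\<close> by (auto dest!: order_tendstoD(2))
  then show ?thesis
    using eventually_ge_at_top[of 1]
  proof eventually_elim
    case (elim n)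
    have Fn: "finite (F n)" "F n \<noteq> {}" "F n \<subseteq> carrier G"
      using F elim by (auto simp: folner_seq_def)
    then have pos: "real (card (F n)) > 0" by (simp add: card_gt_0_iff)
    have "card (boundary G D (F n)) \<le> (\<Sum>g\<in>D. card (sym_diff (F n) (inv g <#\<^bsub>G\<^esub> F n)))"
      unfolding boundary_eq_UN_sym_diff[OF D(2) Fn(3)] by (rule card_UN_le[OF D(1)])
    then have "real (card (boundary G D (F n))) \<le> (\<Sum>g\<in>D. real (card (sym_diff (F n) (inv g <#\<^bsub>G\<^esub> F n))))"
      unfolding of_nat_sum[symmetric] of_nat_le_iff .
    also have "\<dots> = (\<Sum>g\<in>D. ?r (inv g) n) * real (card (F n))"
      using pos by (simp add: sum_distrib_right)
    also have "\<dots> \<le> \<eta> * real (card (F n))"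
      using elim by (intro mult_right_mono) auto
    finally show ?case .
  qed
qed

section \<open>Right translates of finite sets and their greedy selection\<close>

lemma inj_on_rmult: "c \<in> carrier G \<Longrightarrow> inj_on (\<lambda>f. f \<otimes> c) (carrier G)"
  by (intro inj_onI) simp

lemma card_translate:
  "T \<subseteq> carrier G \<Longrightarrow> c \<in> carrier G \<Longrightarrow> card ((\<lambda>f. f \<otimes> c) ` T) = card T"
  by (rule card_image) (rule inj_on_subset[OF inj_on_rmult])

lemma mem_translate_iff:
  assumes "T \<subseteq> carrier G" "c \<in> carrier G" "x \<in> carrier G"
  shows "x \<in> (\<lambda>f. f \<otimes> c) ` T \<longleftrightarrow> x \<otimes> inv c \<in> T"
proof
  assume "x \<in> (\<lambda>f. f \<otimes> c) ` T"
  then show "x \<otimes> inv c \<in> T"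
    using assms by (auto simp: m_assoc subset_iff)
next
  assume "x \<otimes> inv c \<in> T"
  moreover have "x = (x \<otimes> inv c) \<otimes> c" using assms by (simp add: m_assoc)
  ultimately show "x \<in> (\<lambda>f. f \<otimes> c) ` T" by blast
qed

text \<open>Right translation by \<open>c\<close> commutes with left multiplication by
  \<open>D\<close>, so the boundary moves along with \<open>T\<close>; one inclusion
  suffices.\<close>

lemma card_boundary_translate:
  assumes "D \<subseteq> carrier G" "T \<subseteq> carrier G" "c \<in> carrier G" "finite D" "finite T"
  shows "card (boundary G D ((\<lambda>f. f \<otimes> c) ` T)) \<le> card (boundary G D T)"
proof -
  have "boundary G D ((\<lambda>f. f \<otimes> c) ` T) \<subseteq> (\<lambda>f. f \<otimes> c) ` boundary G D T"
  proof
    fix x assume x: "x \<in> boundary G D ((\<lambda>f. f \<otimes> c) ` T)"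
    then have xc: "x \<in> carrier G" by (simp add: boundary_def)
    from x obtain g where g: "g \<in> D"
      "(x \<in> (\<lambda>f. f \<otimes> c) ` T) \<noteq> (g \<otimes> x \<in> (\<lambda>f. f \<otimes> c) ` T)"
      by (auto simp: boundary_def)
    then have "(x \<otimes> inv c \<in> T) \<noteq> (g \<otimes> (x \<otimes> inv c) \<in> T)"
      using assms xc by (subst (asm) (1 2) mem_translate_iff) (auto simp: m_assoc subset_iff)
    then have "x \<otimes> inv c \<in> boundary G D T"
      using g(1) assms xc by (auto simp: boundary_def)
    then show "x \<in> (\<lambda>f. f \<otimes> c) ` boundary G D T"
      using assms xc by (subst mem_translate_iff) (auto simp: boundary_def)
  qed
  then show ?thesis
    using assms by (intro surj_card_le finite_boundary)
qed

text \<open>Centres are inspected in order of decreasing \<open>j\<close>, and a tile is accepted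
  when less than the fraction \<open>\<epsilon>\<close> of it is covered already. An accepted tile
  adds at least the fraction \<open>1 - \<epsilon>\<close> of new points; a rejected one is hit by
  accepted tiles of no smaller index.\<close>

lemma greedy_tiles:
  fixes j :: "'a \<Rightarrow> nat"
  assumes "finite A" "A \<subseteq> carrier G" "0 \<le> \<epsilon>" "\<epsilon> \<le> 1"
    and F: "\<And>c. c \<in> A \<Longrightarrow> finite (F (j c)) \<and> F (j c) \<subseteq> carrier G"
  defines "tile \<equiv> \<lambda>c. (\<lambda>f. f \<otimes> c) ` F (j c)"
  obtains S where "S \<subseteq> A"
    "(1 - \<epsilon>) * (\<Sum>c\<in>S. real (card (F (j c)))) \<le> real (card (\<Union>c\<in>S. tile c))"
    "\<And>c. c \<in> A \<Longrightarrow>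
      \<epsilon> * real (card (F (j c))) \<le> real (card (tile c \<inter> (\<Union>d\<in>{d \<in> S. j c \<le> j d}. tile d)))"
proof -
  have "\<exists>S\<subseteq>A. (1 - \<epsilon>) * (\<Sum>c\<in>S. real (card (F (j c)))) \<le> real (card (\<Union>c\<in>S. tile c)) \<and>
    (\<forall>c\<in>A. \<epsilon> * real (card (F (j c))) \<le> real (card (tile c \<inter> (\<Union>d\<in>{d \<in> S. j c \<le> j d}. tile d))))"
    using assms(1,2) F
  proof (induction A rule: finite_ranking_induct[where f = "\<lambda>c. - int (j c)"])
    case empty
    then show ?case by auto
  next
    case (insert x A)
    then obtain S where S: "S \<subseteq> A"
      "(1 - \<epsilon>) * (\<Sum>c\<in>S. real (card (F (j c)))) \<le> real (card (\<Union>c\<in>S. tile c))"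
      "\<And>c. c \<in> A \<Longrightarrow>
      \<epsilon> * real (card (F (j c))) \<le> real (card (tile c \<inter> (\<Union>d\<in>{d \<in> S. j c \<le> j d}. tile d)))"
      by auto
    have finS: "finite S" using S(1) insert.hyps(1) finite_subset by blast
    have fin: "finite (tile c)" if "c \<in> insert x A" for c
      using insert.prems that by (auto simp: tile_def)
    have cardt: "card (tile c) = card (F (j c))" if "c \<in> insert x A" for c
      unfolding tile_def using insert.prems(1) insert.prems(2)[OF that] that
      by (intro card_translate) auto
    \<comment> \<open>The rank is minus \<open>j\<close>, so the inserted \<open>x\<close> has the
      smallest index so far.\<close>
    have le: "j x \<le> j d" if "d \<in> S" for d using S(1) insert.hyps(2)[of d] that by auto
    have finU: "finite (\<Union>c\<in>S. tile c)" using fin S(1) finS by auto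
    show ?case
    proof (cases "\<epsilon> * real (card (F (j x))) \<le> real (card (tile x \<inter> (\<Union>d\<in>S. tile d)))")
      case True
      have "{d \<in> S. j x \<le> j d} = S" using le by auto
      with True S show ?thesis by (intro exI[of _ S]) auto
    next
      case False
      \<comment> \<open>The ranking induction may insert an \<open>x\<close> that is present
        already; but then its whole tile would be covered, against the case assumption.\<close>
      have "x \<notin> S"
      proof
        assume "x \<in> S"
        then have "tile x \<inter> (\<Union>d\<in>S. tile d) = tile x" by blast
        with False show False using cardt[of x] \<open>\<epsilon> \<le> 1\<close> \<open>0 \<le> \<epsilon>\<close>
          by (simp add: mult_left_le_one_le)
      qed
      let ?S = "insert x S"
      have 1: "(1 - \<epsilon>) * (\<Sum>c\<in>?S. real (card (F (j c)))) \<le> real (card (\<Union>c\<in>?S. tile c))"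
      proof -
        have "card (tile x) + card (\<Union>c\<in>S. tile c) =
            card (\<Union>c\<in>?S. tile c) + card (tile x \<inter> (\<Union>d\<in>S. tile d))"
          using card_Un_Int[OF fin[of x] finU] by simp
        then have "real (card (F (j x))) + real (card (\<Union>c\<in>S. tile c)) =
            real (card (\<Union>c\<in>?S. tile c)) + real (card (tile x \<inter> (\<Union>d\<in>S. tile d)))"
          using cardt[of x] by (simp flip: of_nat_add)
        then show ?thesis
          using False S(2) finS \<open>x \<notin> S\<close> by (simp add: algebra_simps)
      qed
      have 2: "\<epsilon> * real (card (F (j c))) \<le>
          real (card (tile c \<inter> (\<Union>d\<in>{d \<in> ?S. j c \<le> j d}. tile d)))" if "c \<in> insert x A" for c
      proof (cases "c \<in> A")
        case True
        have "card (tile c \<inter> (\<Union>d\<in>{d \<in> S. j c \<le> j d}. tile d)) \<le>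
            card (tile c \<inter> (\<Union>d\<in>{d \<in> ?S. j c \<le> j d}. tile d))"
          using fin[OF that] by (intro card_mono) auto
        then show ?thesis using S(3)[OF True] by linarith
      next
        case False
        then have "c = x" using that by simp
        then have "tile c \<inter> (\<Union>d\<in>{d \<in> ?S. j c \<le> j d}. tile d) = tile c" by blast
        then show ?thesis using cardt[OF that] \<open>\<epsilon> \<le> 1\<close> \<open>0 \<le> \<epsilon>\<close>
          by (simp add: mult_left_le_one_le)
      qed
      show ?thesis using S(1) 1 2 by (intro exI[of _ ?S]) auto
    qed
  qed
  then show ?thesis using that by blast
qed

text \<open>Double counting of the pairs \<open>(f, c)\<close> with
  \<open>f \<otimes> c \<in> B\<close>: left multiplication by a fixed \<open>f\<close> is
  injective, so \<open>f\<close> occurs at most \<open>card B\<close> times.\<close>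

lemma tile_incidence_bound:
  assumes "finite A" "A \<subseteq> carrier G" "finite B" "B \<subseteq> carrier G" "finite T" "T \<subseteq> carrier G"
  shows "(\<Sum>c\<in>A. card ((\<lambda>f. f \<otimes> c) ` T \<inter> B)) \<le> card T * card B"
proof -
  have "card ((\<lambda>f. f \<otimes> c) ` T \<inter> B) = (\<Sum>f\<in>T. if f \<otimes> c \<in> B then 1 else 0)" if "c \<in> A" for c
  proof -
    have "(\<lambda>f. f \<otimes> c) ` T \<inter> B = (\<lambda>f. f \<otimes> c) ` {f \<in> T. f \<otimes> c \<in> B}" by auto
    moreover have "c \<in> carrier G" using that assms by auto
    ultimately have "card ((\<lambda>f. f \<otimes> c) ` T \<inter> B) = card {f \<in> T. f \<otimes> c \<in> B}"
      using card_translate[of "{f \<in> T. f \<otimes> c \<in> B}" c] assms by auto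
    then show ?thesis using assms(5) by (simp add: sum.If_cases Int_def)
  qed
  then have "(\<Sum>c\<in>A. card ((\<lambda>f. f \<otimes> c) ` T \<inter> B)) =
      (\<Sum>f\<in>T. \<Sum>c\<in>A. if f \<otimes> c \<in> B then 1 else 0)"
    by (subst sum.swap) simp
  also have "\<dots> \<le> (\<Sum>f\<in>T. card B)"
  proof (intro sum_mono)
    fix f assume "f \<in> T"
    then have f: "f \<in> carrier G" using assms by auto
    have "(\<Sum>c\<in>A. if f \<otimes> c \<in> B then 1 else 0) = card {c \<in> A. f \<otimes> c \<in> B}"
      using assms(1) by (simp add: sum.If_cases Int_def)
    also have "\<dots> = card ((\<lambda>c. f \<otimes> c) ` {c \<in> A. f \<otimes> c \<in> B})"
      using assms(2) f by (intro card_image[symmetric] inj_on_subset[OF inj_on_cmult]) auto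
    also have "\<dots> \<le> card B" using assms(3) by (intro card_mono) auto
    finally show "(\<Sum>c\<in>A. if f \<otimes> c \<in> B then 1 else 0) \<le> card B" .
  qed
  finally show ?thesis by simp
qed

text \<open>Let \<open>m\<close> be the total size of the accepted tiles. Centres whose tile meets
  an accepted tile of larger index number at most \<open>C * m\<close> by temperedness; the others
  are hit within their own index and number at most \<open>m / \<epsilon>\<close> by double
  counting. Small overlaps make \<open>m\<close> comparable with the covered set.\<close>

lemma quasi_tiling:
  fixes j :: "'a \<Rightarrow> nat"
  assumes A: "finite A" "A \<subseteq> carrier G" and eps: "0 < \<epsilon>" "\<epsilon> < 1"
    and F: "\<And>n. 1 \<le> n \<Longrightarrow> finite (F n) \<and> F n \<noteq> {} \<and> F n \<subseteq> carrier G"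
    and j: "\<And>c. c \<in> A \<Longrightarrow> 1 \<le> j c"
    and C: "\<And>n. 1 \<le> n \<Longrightarrow>
      real (card (\<Union>k\<in>{1..<n}. set_inv (F k) <#> F n)) \<le> C * real (card (F n))"
  defines "tile \<equiv> \<lambda>c. (\<lambda>f. f \<otimes> c) ` F (j c)"
  obtains S where "S \<subseteq> A"
    "(1 - \<epsilon>) * (\<Sum>c\<in>S. real (card (F (j c)))) \<le> real (card (\<Union>c\<in>S. tile c))"
    "(1 - \<epsilon>) * real (card A) \<le> (C + 1 / \<epsilon>) * real (card (\<Union>c\<in>S. tile c))"
proof -
  obtain S where S: "S \<subseteq> A"
    "(1 - \<epsilon>) * (\<Sum>c\<in>S. real (card (F (j c)))) \<le> real (card (\<Union>c\<in>S. tile c))"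
    and hit: "\<And>c. c \<in> A \<Longrightarrow>
      \<epsilon> * real (card (F (j c))) \<le> real (card (tile c \<inter> (\<Union>d\<in>{d \<in> S. j c \<le> j d}. tile d)))"
    unfolding tile_def
  proof (rule greedy_tiles[of A \<epsilon> F j])
    show "finite (F (j c)) \<and> F (j c) \<subseteq> carrier G" if "c \<in> A" for c
      using F[OF j[OF that]] by simp
  qed (use A eps in auto)
  have finS: "finite S" using S(1) A(1) finite_subset by blast
  define m where "m = (\<Sum>c\<in>S. real (card (F (j c))))"
  define A1 where "A1 = {c \<in> A. \<exists>d\<in>S. j c < j d \<and> tile c \<inter> tile d \<noteq> {}}"
  define A2 where "A2 = A - A1"
  let ?H = "\<lambda>n. \<Union>k\<in>{1..<n}. set_inv (F k) <#> F n"
  have finH: "finite (?H n)" if "1 \<le> n" for n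
  proof -
    have "finite (set_inv (F k) <#> F n)" if "k \<in> {1..<n}" for k
      using F[of k] F[of n] that unfolding set_mult_def SET_INV_def by auto
    then show ?thesis by blast
  qed
  have Hsub: "?H n \<subseteq> carrier G" for n
  proof (cases "1 \<le> n")
    case True
    have "set_inv (F k) <#> F n \<subseteq> carrier G" if "k \<in> {1..<n}" for k
      using F[of k] F[OF True] that unfolding set_mult_def SET_INV_def by auto
    then show ?thesis by blast
  qed auto
  \<comment> \<open>A common point \<open>f \<otimes> c = f' \<otimes> d\<close> puts
    \<open>c\<close> into the right translate by \<open>d\<close> of the set that temperedness
    controls at index \<open>j d\<close>.\<close>
  have "A1 \<subseteq> (\<Union>d\<in>S. (\<lambda>h. h \<otimes> d) ` ?H (j d))"
  proof
    fix c assume "c \<in> A1"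
    then obtain d x where d: "c \<in> A" "d \<in> S" "j c < j d" "x \<in> tile c" "x \<in> tile d"
      by (auto simp: A1_def)
    then obtain f f' where f: "f \<in> F (j c)" "f' \<in> F (j d)" "f \<otimes> c = f' \<otimes> d"
      by (auto simp: tile_def)
    have "1 \<le> j c" "1 \<le> j d" using d j S(1) by auto
    then have car: "f \<in> carrier G" "f' \<in> carrier G" "c \<in> carrier G" "d \<in> carrier G"
      using f F d A S(1) by blast+
    have "c = inv f \<otimes> f' \<otimes> d"
      using f(3) car by (metis inv_closed inv_solve_left m_assoc m_closed)
    moreover have "inv f \<otimes> f' \<in> set_inv (F (j c)) <#> F (j d)"
      using f by (auto simp: set_mult_def SET_INV_def)
    moreover have "j c \<in> {1..<j d}" using \<open>1 \<le> j c\<close> d by simp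
    ultimately show "c \<in> (\<Union>d\<in>S. (\<lambda>h. h \<otimes> d) ` ?H (j d))" using d(2) by blast
  qed
  then have "card A1 \<le> card (\<Union>d\<in>S. (\<lambda>h. h \<otimes> d) ` ?H (j d))"
    using finS S(1) j by (intro card_mono finite_UN_I finite_imageI finH) auto
  also have "\<dots> \<le> (\<Sum>d\<in>S. card ((\<lambda>h. h \<otimes> d) ` ?H (j d)))"
    by (rule card_UN_le[OF finS])
  also have "\<dots> \<le> (\<Sum>d\<in>S. card (?H (j d)))"
    using S(1) j by (intro sum_mono card_image_le finH) auto
  finally have "real (card A1) \<le> (\<Sum>d\<in>S. real (card (?H (j d))))"
    unfolding of_nat_sum[symmetric] of_nat_le_iff .
  also have "\<dots> \<le> (\<Sum>d\<in>S. C * real (card (F (j d))))"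
    using S(1) j by (intro sum_mono C) auto
  finally have A1: "real (card A1) \<le> C * m" by (simp add: m_def sum_distrib_left)

  \<comment> \<open>One index at a time, since the incidence bound needs a single tile shape
    \<open>F n\<close>.\<close>
  have lev: "\<epsilon> * real (card {c \<in> A2. j c = n}) \<le> (\<Sum>d\<in>{d \<in> S. j d = n}. real (card (F (j d))))"
    if n: "1 \<le> n" for n
  proof -
    let ?A = "{c \<in> A2. j c = n}" and ?B = "\<Union>d\<in>{d \<in> S. j d = n}. tile d"
    have Fn: "finite (F n)" "F n \<noteq> {}" "F n \<subseteq> carrier G" using F[OF n] by auto
    have B: "finite ?B" "?B \<subseteq> carrier G"
      using finS Fn S(1) A(2) by (auto simp: tile_def)
    have "\<epsilon> * real (card (F n)) \<le> real (card ((\<lambda>f. f \<otimes> c) ` F n \<inter> ?B))" if c: "c \<in> ?A" for c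
    proof -
      \<comment> \<open>As \<open>c\<close> is not in \<open>A1\<close>, accepted tiles of larger
        index miss its tile; only those of index \<open>n\<close> remain.\<close>
      have "tile c \<inter> (\<Union>d\<in>{d \<in> S. j c \<le> j d}. tile d) \<subseteq> (\<lambda>f. f \<otimes> c) ` F n \<inter> ?B"
        using c by (force simp: A2_def A1_def tile_def)
      then have "card (tile c \<inter> (\<Union>d\<in>{d \<in> S. j c \<le> j d}. tile d)) \<le> card ((\<lambda>f. f \<otimes> c) ` F n \<inter> ?B)"
        using Fn by (intro card_mono) auto
      then show ?thesis using hit[of c] c by (auto simp: A2_def)
    qed
    then have "(\<Sum>c\<in>?A. \<epsilon> * real (card (F n))) \<le> (\<Sum>c\<in>?A. real (card ((\<lambda>f. f \<otimes> c) ` F n \<inter> ?B)))"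
      by (intro sum_mono) auto
    also have "\<dots> = real (\<Sum>c\<in>?A. card ((\<lambda>f. f \<otimes> c) ` F n \<inter> ?B))" by simp
    also have "\<dots> \<le> real (card (F n) * card ?B)"
    proof -
      have "finite ?A" "?A \<subseteq> carrier G" using A by (auto simp: A2_def)
      then show ?thesis using tile_incidence_bound[of ?A ?B "F n"] B Fn by linarith
    qed
    finally have "real (card (F n)) * (\<epsilon> * real (card ?A)) \<le> real (card (F n)) * real (card ?B)"
      by (simp add: algebra_simps)
    then have "\<epsilon> * real (card ?A) \<le> real (card ?B)"
      using Fn by (simp add: card_gt_0_iff)
    also have "\<dots> \<le> real (\<Sum>d\<in>{d \<in> S. j d = n}. card (tile d))"
      using card_UN_le[of "{d \<in> S. j d = n}" tile] finS by (auto simp del: of_nat_sum)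
    also have "\<dots> \<le> real (\<Sum>d\<in>{d \<in> S. j d = n}. card (F (j d)))"
      unfolding of_nat_le_iff using Fn by (intro sum_mono) (auto simp: tile_def card_image_le)
    finally show ?thesis by simp
  qed
  have "\<epsilon> * real (card A2) \<le> m"
  proof -
    have fin: "finite A2" "finite (j ` A)" using A by (auto simp: A2_def)
    have "A2 = (\<Union>n\<in>j ` A. {c \<in> A2. j c = n})" by (auto simp: A2_def)
    then have "card A2 \<le> (\<Sum>n\<in>j ` A. card {c \<in> A2. j c = n})"
      using card_UN_le[OF fin(2)] by metis
    then have "real (card A2) \<le> (\<Sum>n\<in>j ` A. real (card {c \<in> A2. j c = n}))"
      unfolding of_nat_sum[symmetric] of_nat_le_iff .
    then have "\<epsilon> * real (card A2) \<le> (\<Sum>n\<in>j ` A. \<epsilon> * real (card {c \<in> A2. j c = n}))"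
      using eps by (simp flip: sum_distrib_left)
    also have "\<dots> \<le> (\<Sum>n\<in>j ` A. \<Sum>d\<in>{d \<in> S. j d = n}. real (card (F (j d))))"
      using j by (intro sum_mono lev) auto
    also have "\<dots> = m"
      unfolding m_def using finS fin S(1) by (intro sum.group) auto
    finally show ?thesis .
  qed
  then have "real (card A2) \<le> m / \<epsilon>" using eps by (simp add: field_simps)
  moreover have "real (card A) = real (card A1) + real (card A2)"
  proof -
    have "card A = card A1 + card A2"
      unfolding A2_def using A by (subst card_Diff_subset) (auto simp: A1_def card_mono)
    then show ?thesis by simp
  qed
  ultimately have le: "real (card A) \<le> (C + 1 / \<epsilon>) * m"
    using A1 by (simp add: algebra_simps)
  \<comment> \<open>At index 1 the union over \<open>{1..<1}\<close> is empty, so \<open>C\<close>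
    cannot be negative.\<close>
  have "0 \<le> C"
  proof -
    have "0 \<le> C * real (card (F 1))" using C[of 1] by simp
    then show ?thesis using F[of 1] by (simp add: zero_le_mult_iff card_gt_0_iff)
  qed
  have "(1 - \<epsilon>) * real (card A) \<le> (1 - \<epsilon>) * ((C + 1 / \<epsilon>) * m)"
    using eps le by (intro mult_left_mono) auto
  also have "\<dots> = (C + 1 / \<epsilon>) * ((1 - \<epsilon>) * m)" by simp
  also have "\<dots> \<le> (C + 1 / \<epsilon>) * real (card (\<Union>c\<in>S. tile c))"
    using S(2) eps \<open>0 \<le> C\<close> unfolding m_def by (intro mult_left_mono) auto
  finally show ?thesis using that[OF S] by blast
qed

end

section \<open>Minimal subcovers of joins\<close>

lemma cover_number_le:
  "\<W> \<subseteq> \<V> \<Longrightarrow> finite \<W> \<Longrightarrow> \<Union>\<W> = UNIV \<Longrightarrow> cover_number \<V> \<le> card \<W>"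
  unfolding cover_number_def by (rule Least_le) blast

lemma cover_number_attained:
  assumes "\<exists>\<W>\<subseteq>\<V>. finite \<W> \<and> \<Union>\<W> = UNIV"
  obtains \<W> where "\<W> \<subseteq> \<V>" "finite \<W>" "\<Union>\<W> = UNIV" "card \<W> = cover_number \<V>"
proof -
  from assms have "\<exists>n. \<exists>\<W>\<subseteq>\<V>. finite \<W> \<and> \<Union>\<W> = UNIV \<and> card \<W> = n" by auto
  from LeastI_ex[OF this] show ?thesis using that by (auto simp: cover_number_def)
qed

lemma cover_join_mono: "\<V> \<subseteq> \<U> \<Longrightarrow> cover_join \<phi> \<V> E \<subseteq> cover_join \<phi> \<U> E"
  unfolding cover_join_def by (auto 0 4)

text \<open>Words over a finite subcover \<open>\<V>\<close> already cover, so \<open>\<U>\<close>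
  itself may be infinite; extensional functions make the words finite in number.\<close>

lemma cover_join_subcover:
  assumes "\<V> \<subseteq> \<U>" "finite \<V>" "\<Union>\<V> = UNIV" "finite E"
  obtains \<W> where "\<W> \<subseteq> cover_join \<phi> \<U> E" "finite \<W>" "\<Union>\<W> = UNIV" "card \<W> \<le> card \<V> ^ card E"
proof
  let ?W = "(\<lambda>v. \<Inter>g\<in>E. \<phi> g -` v g) ` (E \<rightarrow>\<^sub>E \<V>)"
  show "?W \<subseteq> cover_join \<phi> \<U> E"
    using assms(1) unfolding cover_join_def by (fastforce simp: PiE_iff)
  show "finite ?W" using assms by (intro finite_imageI finite_PiE) auto
  show "\<Union>?W = UNIV"
  proof (rule UNIV_eq_I[symmetric])
    fix x
    have "\<forall>g. \<exists>V\<in>\<V>. \<phi> g x \<in> V" using assms(3) by blast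
    then obtain v where v: "\<And>g. v g \<in> \<V> \<and> \<phi> g x \<in> v g" by metis
    then have "(\<Inter>g\<in>E. \<phi> g -` restrict v E g) \<in> ?W" by (intro imageI) auto
    moreover have "x \<in> (\<Inter>g\<in>E. \<phi> g -` restrict v E g)" using v by auto
    ultimately show "x \<in> \<Union>?W" by (rule UnionI)
  qed
  have "card ?W \<le> card (E \<rightarrow>\<^sub>E \<V>)" using assms by (intro card_image_le finite_PiE) auto
  then show "card ?W \<le> card \<V> ^ card E" using assms by (simp add: card_PiE)
qed

lemma cover_join_attained:
  assumes "\<V> \<subseteq> \<U>" "finite \<V>" "\<Union>\<V> = UNIV" "finite E"
  obtains \<W> where "\<W> \<subseteq> cover_join \<phi> \<U> E" "finite \<W>" "\<Union>\<W> = UNIV"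
    "card \<W> = cover_number (cover_join \<phi> \<U> E)"
proof (rule cover_number_attained)
  show "\<exists>\<W>\<subseteq>cover_join \<phi> \<U> E. finite \<W> \<and> \<Union>\<W> = UNIV"
    using cover_join_subcover[OF assms, of \<phi>] by metis
qed (use that in blast)

text \<open>The empty family cannot cover an inhabited type, which keeps \<open>ln\<close> away from
  the argument 0. The upper bound counts words.\<close>

lemma cover_number_join_bounds:
  assumes "\<V> \<subseteq> \<U>" "finite \<V>" "\<Union>\<V> = UNIV" "finite E"
  shows "1 \<le> cover_number (cover_join \<phi> \<U> E)"
    and "cover_number (cover_join \<phi> \<U> E) \<le> card \<V> ^ card E"
proof -
  obtain \<W> where W: "\<W> \<subseteq> cover_join \<phi> \<U> E" "finite \<W>" "\<Union>\<W> = UNIV" "card \<W> = cover_number (cover_join \<phi> \<U> E)"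
    by (rule cover_join_attained[OF assms, where \<phi> = \<phi>])
  then have "\<W> \<noteq> {}" by auto
  with W show "1 \<le> cover_number (cover_join \<phi> \<U> E)"
    by (metis One_nat_def Suc_leI card_gt_0_iff)
  show "cover_number (cover_join \<phi> \<U> E) \<le> card \<V> ^ card E"
    using cover_join_subcover[OF assms, of \<phi>] cover_number_le by (metis order_trans)
qed

lemma cover_number_join_antimono:
  assumes "\<V> \<subseteq> \<U>" "finite \<V>" "\<Union>\<V> = UNIV" "finite E"
  shows "cover_number (cover_join \<phi> \<U> E) \<le> cover_number (cover_join \<phi> \<V> E)"
proof -
  obtain \<W> where "\<W> \<subseteq> cover_join \<phi> \<V> E" "finite \<W>" "\<Union>\<W> = UNIV"
    "card \<W> = cover_number (cover_join \<phi> \<V> E)"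
    by (rule cover_join_attained[OF order_refl assms(2-4)])
  then show ?thesis
    using cover_join_mono[OF assms(1)] cover_number_le by (metis order_trans)
qed

text \<open>If the space is split into pieces \<open>P i\<close>, on each of which the coordinates in \<open>E - R i\<close> are
  already prescribed, only the coordinates in \<open>R i\<close> remain to be covered.\<close>

lemma cover_number_join_le_sum:
  assumes V: "\<V> \<subseteq> \<U>" "finite \<V>" "\<Union>\<V> = UNIV" and "finite E" and "finite I"
    and R: "\<And>i. i \<in> I \<Longrightarrow> R i \<subseteq> E"
    and a: "\<And>i g. i \<in> I \<Longrightarrow> g \<in> E - R i \<Longrightarrow> a i g \<in> \<U> \<and> P i \<subseteq> \<phi> g -` a i g"
    and P: "\<And>x. \<exists>i\<in>I. x \<in> P i"
  shows "cover_number (cover_join \<phi> \<U> E) \<le> (\<Sum>i\<in>I. cover_number (cover_join \<phi> \<U> (R i)))"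
proof -
  have "\<exists>\<W>. \<W> \<subseteq> cover_join \<phi> \<U> (R i) \<and> finite \<W> \<and> \<Union>\<W> = UNIV \<and>
      card \<W> = cover_number (cover_join \<phi> \<U> (R i))" if "i \<in> I" for i
    using cover_join_attained[OF V, of "R i" \<phi>] R[OF that] \<open>finite E\<close>
    by (metis finite_subset)
  then obtain W where W: "\<And>i. i \<in> I \<Longrightarrow> W i \<subseteq> cover_join \<phi> \<U> (R i)"
    "\<And>i. i \<in> I \<Longrightarrow> finite (W i)" "\<And>i. i \<in> I \<Longrightarrow> \<Union>(W i) = UNIV"
    "\<And>i. i \<in> I \<Longrightarrow> card (W i) = cover_number (cover_join \<phi> \<U> (R i))"
    by metis
  have "\<exists>v. Y = (\<Inter>g\<in>R i. \<phi> g -` v g) \<and> (\<forall>g\<in>R i. v g \<in> \<U>)" if "i \<in> I" "Y \<in> W i" for i Y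
    using W(1)[OF that(1)] that(2) by (auto simp: cover_join_def)
  then obtain v where v: "\<And>i Y. i \<in> I \<Longrightarrow> Y \<in> W i \<Longrightarrow> Y = (\<Inter>g\<in>R i. \<phi> g -` v i Y g)"
    "\<And>i Y g. i \<in> I \<Longrightarrow> Y \<in> W i \<Longrightarrow> g \<in> R i \<Longrightarrow> v i Y g \<in> \<U>"
    by metis
  \<comment> \<open>Glued words: the letters of the chosen subcover on \<open>R i\<close>, the
    prescribed letters elsewhere.\<close>
  define u where "u = (\<lambda>i Y g. if g \<in> R i then v i Y g else a i g)"
  define z where "z = (\<lambda>(i, Y). \<Inter>g\<in>E. \<phi> g -` u i Y g)"
  have fin: "finite (Sigma I W)" using \<open>finite I\<close> W(2) by auto
  have "cover_number (cover_join \<phi> \<U> E) \<le> card (z ` Sigma I W)"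
  proof (rule cover_number_le)
    show "z ` Sigma I W \<subseteq> cover_join \<phi> \<U> E"
    proof clarify
      fix i Y assume "i \<in> I" "Y \<in> W i"
      then have "\<forall>g\<in>E. u i Y g \<in> \<U>" using v(2) a by (auto simp: u_def)
      then show "z (i, Y) \<in> cover_join \<phi> \<U> E" by (auto simp: z_def cover_join_def)
    qed
    show "\<Union>(z ` Sigma I W) = UNIV"
    proof (rule UNIV_eq_I[symmetric])
      fix x
      obtain i where i: "i \<in> I" "x \<in> P i" using P by blast
      then obtain Y where Y: "Y \<in> W i" "x \<in> Y" using W(3) by blast
      then have xv: "\<phi> g x \<in> v i Y g" if "g \<in> R i" for g
        using v(1)[OF i(1) Y(1)] that by blast
      moreover have "\<phi> g x \<in> a i g" if "g \<in> E - R i" for g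
        using a[OF i(1) that] i(2) by blast
      ultimately have "x \<in> z (i, Y)" by (auto simp: z_def u_def)
      then show "x \<in> \<Union>(z ` Sigma I W)" using i(1) Y(1) by blast
    qed
  qed (use fin in auto)
  also have "\<dots> \<le> card (Sigma I W)" by (rule card_image_le[OF fin])
  also have "\<dots> = (\<Sum>i\<in>I. card (W i))" using \<open>finite I\<close> W(2) by (simp add: card_SigmaI)
  also have "\<dots> = (\<Sum>i\<in>I. cover_number (cover_join \<phi> \<U> (R i)))" using W(4) by simp
  finally show ?thesis .
qed

section \<open>The Bowen outer measures\<close>

text \<open>A larger \<open>N\<close> leaves fewer admissible families, so the infimum can only grow
  and the limit in \<open>bowen_M\<close> is a supremum.\<close>

lemma bowen_M_N_mono: "N \<le> N' \<Longrightarrow> bowen_M_N \<phi> F Z \<U> N s \<le> bowen_M_N \<phi> F Z \<U> N' s"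
  unfolding bowen_M_N_def by (rule INF_superset_mono) force+

lemma bowen_M_eq_SUP: "bowen_M \<phi> F Z \<U> s = (SUP N. bowen_M_N \<phi> F Z \<U> N s)"
  unfolding bowen_M_def
  by (intro limI LIMSEQ_SUP monoI bowen_M_N_mono)

lemma bowen_M_eq_0_iff: "bowen_M \<phi> F Z \<U> s = 0 \<longleftrightarrow> (\<forall>N. bowen_M_N \<phi> F Z \<U> N s = 0)"
  unfolding bowen_M_eq_SUP by (metis (no_types, lifting) SUP_eq_const SUP_upper UNIV_I UNIV_not_empty le_zero_eq)

text \<open>A minimal subcover at one good index \<open>n\<close> is a Bowen cover of weight at most
  \<open>exp (real (card (F n)) * (b - s))\<close>. Good indices are unbounded and
  \<open>card (F n)\<close> tends to infinity, so beyond any \<open>N\<close> this weight gets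
  arbitrarily small.\<close>

lemma bowen_M_eq_0I:
  assumes F: "\<And>n. 1 \<le> n \<Longrightarrow> finite (F n)"
    and V: "\<V> \<subseteq> \<U>" "finite \<V>" "\<Union>\<V> = UNIV"
    and growth: "filterlim (\<lambda>n. card (F n)) at_top sequentially"
    and freq: "\<exists>\<^sub>F n in sequentially. ln (real (cover_number (cover_join \<phi> \<U> (F n)))) \<le> b * real (card (F n))"
    and "b < s"
  shows "bowen_M \<phi> F Z \<U> s = 0"
  unfolding bowen_M_eq_0_iff
proof
  fix N
  have "bowen_M_N \<phi> F Z \<U> N s \<le> ennreal e" if "e > 0" for e
  proof -
    have "filterlim (\<lambda>n. real (card (F n))) at_top sequentially"
      by (rule filterlim_compose[OF filterlim_real_sequentially growth])
    then have "filterlim (\<lambda>n. real (card (F n)) * (b - s)) at_bot sequentially"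
      using \<open>b < s\<close> by (intro filterlim_tendsto_neg_mult_at_bot[OF tendsto_const[of "b - s"], simplified mult.commute]) auto
    then have "((\<lambda>n. exp (real (card (F n)) * (b - s))) \<longlongrightarrow> 0) sequentially"
      by (rule filterlim_compose[OF exp_at_bot])
    then have "\<forall>\<^sub>F n in sequentially. exp (real (card (F n)) * (b - s)) < e"
      using \<open>e > 0\<close> by (rule order_tendstoD)
    with eventually_ge_at_top[of "max 1 N"]
    have "\<forall>\<^sub>F n in sequentially. max 1 N \<le> n \<and> exp (real (card (F n)) * (b - s)) < e"
      by eventually_elim auto
    with freq have "\<exists>\<^sub>F n in sequentially. ln (real (cover_number (cover_join \<phi> \<U> (F n)))) \<le> b * real (card (F n))
        \<and> max 1 N \<le> n \<and> exp (real (card (F n)) * (b - s)) < e"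
      by (rule frequently_eventually_frequently)
    then obtain n where n: "ln (real (cover_number (cover_join \<phi> \<U> (F n)))) \<le> b * real (card (F n))"
      "1 \<le> n" "N \<le> n" "exp (real (card (F n)) * (b - s)) < e"
      by (auto dest: frequently_ex)
    obtain \<W> where W: "\<W> \<subseteq> cover_join \<phi> \<U> (F n)" "finite \<W>" "\<Union>\<W> = UNIV"
      "card \<W> = cover_number (cover_join \<phi> \<U> (F n))"
      by (rule cover_join_attained[OF V F[OF n(2)]])
    have "\<forall>Y\<in>\<W>. \<exists>v. Y = (\<Inter>g\<in>F n. \<phi> g -` v g) \<and> (\<forall>g\<in>F n. v g \<in> \<U>)"
      using W(1) by (auto simp: cover_join_def)
    then obtain v where v: "\<And>Y. Y \<in> \<W> \<Longrightarrow> Y = (\<Inter>g\<in>F n. \<phi> g -` v Y g)"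
      "\<And>Y g. Y \<in> \<W> \<Longrightarrow> g \<in> F n \<Longrightarrow> v Y g \<in> \<U>"
      by metis
    \<comment> \<open>\<open>None\<close> off \<open>F n\<close> gives each word the exact domain
      that \<open>families\<close> demands and from which its weight is read.\<close>
    define u where "u = (\<lambda>Y g. if g \<in> F n then Some (v Y g) else None)"
    have dom_u: "dom (u Y) = F n" for Y by (auto simp: u_def dom_def)
    have fam: "family_set \<phi> (u Y) = Y" if "Y \<in> \<W>" for Y
      unfolding family_set_def dom_u by (subst (2) v(1)[OF that]) (auto simp: u_def)
    have "u ` \<W> \<subseteq> families \<U> (F n)"
      using v(2) by (auto simp: families_def dom_u ran_def u_def split: if_splits)
    then have "u ` \<W> \<in> {\<Lambda>. \<Lambda> \<subseteq> (\<Union>j\<in>{j. 1 \<le> j \<and> N \<le> j}. families \<U> (F j)) \<and>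
        Z \<subseteq> (\<Union>u\<in>\<Lambda>. family_set \<phi> u)}"
      using n W(3) fam by auto
    then have "bowen_M_N \<phi> F Z \<U> N s \<le> (\<Sum>\<^sub>\<infinity>w\<in>u ` \<W>. ennreal (exp (- s * real (card (dom w)))))"
      unfolding bowen_M_N_def by (rule INF_lower)
    also have "\<dots> = (\<Sum>w\<in>u ` \<W>. ennreal (exp (- s * real (card (F n)))))"
    proof -
      have "(\<Sum>\<^sub>\<infinity>w\<in>u ` \<W>. ennreal (exp (- s * real (card (dom w))))) =
          (\<Sum>w\<in>u ` \<W>. ennreal (exp (- s * real (card (dom w)))))"
        using W(2) by (intro infsum_finite) simp
      also have "\<dots> = (\<Sum>w\<in>u ` \<W>. ennreal (exp (- s * real (card (F n)))))"
        by (intro sum.cong) (auto simp: dom_u)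
      finally show ?thesis .
    qed
    also have "\<dots> = ennreal (real (card (u ` \<W>)) * exp (- s * real (card (F n))))"
      by (simp add: ennreal_mult'' ennreal_of_nat_eq_real_of_nat)
    also have "\<dots> \<le> ennreal (exp (b * real (card (F n))) * exp (- s * real (card (F n))))"
    proof (intro ennreal_leI mult_right_mono)
      have "real (card (u ` \<W>)) \<le> real (cover_number (cover_join \<phi> \<U> (F n)))"
        using W card_image_le by (metis of_nat_le_iff)
      also have "\<dots> = exp (ln \<dots>)"
        using cover_number_join_bounds(1)[OF V F[OF n(2)], of \<phi>] by (subst exp_ln) auto
      also have "\<dots> \<le> exp (b * real (card (F n)))" using n(1) by simp
      finally show "real (card (u ` \<W>)) \<le> exp (b * real (card (F n)))" .
    qed simp
    also have "\<dots> = ennreal (exp (real (card (F n)) * (b - s)))"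
      by (simp add: algebra_simps flip: exp_add)
    also have "\<dots> \<le> ennreal e" using n(4) by (intro ennreal_leI) simp
    finally show ?thesis .
  qed
  then show "bowen_M_N \<phi> F Z \<U> N s = 0"
    by (metis ennreal_le_epsilon add_0 zero_less_one le_zero_eq)
qed

lemma sum_le_infsum_ennreal:
  fixes f :: "'a \<Rightarrow> ennreal"
  assumes "finite A" "A \<subseteq> B"
  shows "sum f A \<le> infsum f B"
proof -
  have "infsum f A \<le> infsum f B"
    by (rule infsum_mono_neutral) (use assms in \<open>auto intro: nonneg_summable_on_complete\<close>)
  then show ?thesis using assms(1) by simp
qed

text \<open>The sets \<open>family_set \<phi> u\<close> are finite intersections of open preimages,
  so a cover of small weight has a finite subcover, of no larger weight. \<open>H\<close> stands for
  the carrier of the acting group.\<close>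

lemma bowen_M_eq_0_finite_cover:
  fixes \<phi> :: "'g \<Rightarrow> 'x::topological_space \<Rightarrow> 'x"
  assumes "bowen_M \<phi> F UNIV \<U> s = 0" and "compact (UNIV :: 'x set)" and "open_cover \<U>"
    and F: "\<And>n. 1 \<le> n \<Longrightarrow> finite (F n) \<and> F n \<subseteq> H"
    and cont: "\<And>g. g \<in> H \<Longrightarrow> continuous_on UNIV (\<phi> g)"
    and "\<tau> > 0"
  obtains \<Lambda> where "finite \<Lambda>" "\<Lambda> \<subseteq> (\<Union>j\<in>{j. 1 \<le> j \<and> N \<le> j}. families \<U> (F j))"
    "\<forall>x. \<exists>u\<in>\<Lambda>. x \<in> family_set \<phi> u" "(\<Sum>u\<in>\<Lambda>. exp (- s * real (card (dom u)))) < \<tau>"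
proof -
  have "bowen_M_N \<phi> F UNIV \<U> N s < ennreal \<tau>"
    using assms(1) \<open>\<tau> > 0\<close> by (simp add: bowen_M_eq_0_iff)
  then obtain \<Lambda> where L: "\<Lambda> \<subseteq> (\<Union>j\<in>{j. 1 \<le> j \<and> N \<le> j}. families \<U> (F j))"
    "UNIV \<subseteq> (\<Union>u\<in>\<Lambda>. family_set \<phi> u)"
    "(\<Sum>\<^sub>\<infinity>u\<in>\<Lambda>. ennreal (exp (- s * real (card (dom u))))) < ennreal \<tau>"
    unfolding bowen_M_N_def INF_less_iff by auto
  have "open (family_set \<phi> u)" if "u \<in> \<Lambda>" for u
  proof -
    obtain j where j: "1 \<le> j" "dom u = F j" "ran u \<subseteq> \<U>"
      using L(1) \<open>u \<in> \<Lambda>\<close> by (auto simp: families_def)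
    show ?thesis unfolding family_set_def
    proof (rule open_INT)
      show "finite (dom u)" using F[OF j(1)] j(2) by simp
      show "\<forall>g\<in>dom u. open (\<phi> g -` the (u g))"
      proof
        fix g assume g: "g \<in> dom u"
        then have "the (u g) \<in> \<U>" using j(3) by (auto simp: ran_def)
        then have "open (the (u g))" using \<open>open_cover \<U>\<close> by (auto simp: open_cover_def)
        moreover have "continuous_on UNIV (\<phi> g)" using g F[OF j(1)] j(2) cont by blast
        ultimately show "open (\<phi> g -` the (u g))" by (rule open_vimage)
      qed
    qed
  qed
  then obtain \<Lambda>' where L': "\<Lambda>' \<subseteq> \<Lambda>" "finite \<Lambda>'" "UNIV \<subseteq> (\<Union>u\<in>\<Lambda>'. family_set \<phi> u)"
    using compactE_image[OF assms(2) _ L(2)] by metis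
  have "ennreal (\<Sum>u\<in>\<Lambda>'. exp (- s * real (card (dom u)))) =
      (\<Sum>u\<in>\<Lambda>'. ennreal (exp (- s * real (card (dom u)))))"
    by (simp add: sum_ennreal)
  also have "\<dots> \<le> (\<Sum>\<^sub>\<infinity>u\<in>\<Lambda>. ennreal (exp (- s * real (card (dom u)))))"
    by (rule sum_le_infsum_ennreal[OF L'(2,1)])
  also have "\<dots> < ennreal \<tau>" by (rule L(3))
  finally have "(\<Sum>u\<in>\<Lambda>'. exp (- s * real (card (dom u)))) < \<tau>"
    using ennreal_less_iff by (metis exp_ge_zero sum_nonneg)
  moreover have "\<exists>u\<in>\<Lambda>'. x \<in> family_set \<phi> u" for x using L'(3) by blast
  ultimately show ?thesis using that[of \<Lambda>'] L' L(1) by blast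
qed

section \<open>Counting by quasi-tilings\<close>

locale compact_action = group G for G (structure) +
  fixes \<phi> :: "'a \<Rightarrow> 'x::topological_space \<Rightarrow> 'x"
  assumes compact_UNIV: "compact (UNIV :: 'x set)"
    and action_mult: "g \<in> carrier G \<Longrightarrow> h \<in> carrier G \<Longrightarrow> \<phi> (g \<otimes> h) x = \<phi> g (\<phi> h x)"
    and action_continuous: "g \<in> carrier G \<Longrightarrow> continuous_on UNIV (\<phi> g)"
begin

abbreviation join_number :: "'x set set \<Rightarrow> 'a set \<Rightarrow> nat" where
  "join_number \<U> E \<equiv> cover_number (cover_join \<phi> \<U> E)"

lemma open_cover_finite_subcover:
  fixes \<U> :: "'x set set"
  assumes "open_cover \<U>"
  obtains \<V> where "\<V> \<subseteq> \<U>" "finite \<V>" "\<Union>\<V> = UNIV"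
proof (rule compactE[OF compact_UNIV, of \<U>])
  show "UNIV \<subseteq> \<Union>\<U>" "\<And>B. B \<in> \<U> \<Longrightarrow> open B"
    using assms by (auto simp: open_cover_def)
qed (use that in blast)

text \<open>One round of tiling. The space is covered by pieces \<open>P \<kappa>\<close>, where
  \<open>\<kappa>\<close> says at which centres a word of \<open>\<Lambda>\<close> is laid as a
  tile. Tiles prescribe letters, so only \<open>E - Cov \<kappa>\<close> remains, bounded by
  \<open>rest\<close>, and the weights of the words account for the covered points. \<open>K\<close>
  is free and may depend on \<open>E\<close>; \<open>D0\<close> is the shape under which remainders
  must stay nearly invariant.\<close>

lemma join_number_quasi_tiling:
  fixes F :: "nat \<Rightarrow> 'a set"
  assumes V: "\<V> \<subseteq> \<U>" "finite \<V>" "\<Union>\<V> = UNIV"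
    and F: "\<And>n. 1 \<le> n \<Longrightarrow> finite (F n) \<and> F n \<noteq> {} \<and> F n \<subseteq> carrier G"
    and C: "\<And>n. 1 \<le> n \<Longrightarrow>
      real (card (\<Union>k\<in>{1..<n}. set_inv (F k) <#> F n)) \<le> C * real (card (F n))"
    and eps: "0 < \<epsilon>" "\<epsilon> < 1" and "0 \<le> s"
    and fin\<Lambda>: "finite \<Lambda>" and \<Lambda>: "\<Lambda> \<subseteq> (\<Union>j\<in>{j. 1 \<le> j \<and> M \<le> j}. families \<U> (F j))"
    and cov: "\<And>x. \<exists>u\<in>\<Lambda>. x \<in> family_set \<phi> u"
    and wt: "(\<Sum>u\<in>\<Lambda>. exp (- s * real (card (dom u)))) \<le> \<tau>"
    and E: "finite E" "E \<subseteq> carrier G"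
    and D: "\<And>u. u \<in> \<Lambda> \<Longrightarrow> dom u \<subseteq> D" "finite D" "D \<subseteq> carrier G"
    and D0: "finite D0" "D0 \<subseteq> carrier G"
    and M: "\<And>n. M \<le> n \<Longrightarrow> real (card (boundary G D0 (F n))) \<le> \<eta> * real (card (F n))"
    and \<gamma>: "0 \<le> \<gamma>" "\<gamma> * (C + 1 / \<epsilon>) \<le> 1 - \<epsilon>"
    and rest: "\<And>R. R \<subseteq> E \<Longrightarrow>
      real (card R) \<le> (1 - \<gamma>) * real (card E) + \<gamma> * real (card (boundary G D E)) \<Longrightarrow>
      (1 - \<epsilon>) * (real (card (boundary G D0 R)) - real (card (boundary G D0 E))) \<le> \<eta> * real (card E) \<Longrightarrow>
      real (join_number \<U> R) \<le> exp (s / (1 - \<epsilon>) * real (card R) + K)"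
  shows "real (join_number \<U> E) \<le> exp ((s / (1 - \<epsilon>) + \<tau>) * real (card E) + K)"
proof -
  have "\<forall>u\<in>\<Lambda>. \<exists>j. 1 \<le> j \<and> M \<le> j \<and> dom u = F j \<and> ran u \<subseteq> \<U>"
    using \<Lambda> by (force simp: families_def)
  then obtain idx where idx: "\<And>u. u \<in> \<Lambda> \<Longrightarrow> 1 \<le> idx u" "\<And>u. u \<in> \<Lambda> \<Longrightarrow> M \<le> idx u"
    "\<And>u. u \<in> \<Lambda> \<Longrightarrow> dom u = F (idx u)" "\<And>u. u \<in> \<Lambda> \<Longrightarrow> ran u \<subseteq> \<U>"
    by metis
  have domu: "finite (dom u)" "dom u \<subseteq> carrier G" if "u \<in> \<Lambda>" for u
    using F[OF idx(1)[OF that]] idx(3)[OF that] by auto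
  \<comment> \<open>Centres from which every tile of \<open>\<Lambda>\<close> stays inside
    \<open>E\<close>.\<close>
  define A where "A = E - boundary G D E"
  \<comment> \<open>\<open>None\<close> leaves a centre without a tile; \<open>Some u\<close> lays
    there the translate of \<open>dom u\<close> with word \<open>u\<close>.\<close>
  define Q where "Q = (E \<rightarrow>\<^sub>E insert None (Some ` \<Lambda>))"
  define S where "S = (\<lambda>\<kappa>. {c \<in> E. \<kappa> c \<noteq> (None :: ('a \<rightharpoonup> 'x set) option)})"
  define tile where "tile = (\<lambda>\<kappa> c. (\<lambda>f. f \<otimes> c) ` dom (the (\<kappa> c :: ('a \<rightharpoonup> 'x set) option)))"
  define Cov where "Cov = (\<lambda>\<kappa>. \<Union>c\<in>S \<kappa>. tile \<kappa> c)"
  define m where "m = (\<lambda>\<kappa>. \<Sum>c\<in>S \<kappa>. real (card (dom (the (\<kappa> c)))))"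
  define I where "I = {\<kappa> \<in> Q. Cov \<kappa> \<subseteq> E \<and> (1 - \<epsilon>) * m \<kappa> \<le> real (card (Cov \<kappa>)) \<and>
    \<gamma> * real (card A) \<le> real (card (Cov \<kappa>))}"
  define P where "P = (\<lambda>\<kappa>. {x. \<forall>c\<in>S \<kappa>. \<phi> c x \<in> family_set \<phi> (the (\<kappa> c))})"
  have finQ: "finite Q" unfolding Q_def using E(1) fin\<Lambda> by (intro finite_PiE) auto
  then have finI: "finite I" by (simp add: I_def)
  have in\<Lambda>: "the (\<kappa> c) \<in> \<Lambda>" if "\<kappa> \<in> Q" "c \<in> S \<kappa>" for \<kappa> c
    using that by (fastforce simp: Q_def S_def PiE_iff)
  have finS: "finite (S \<kappa>)" for \<kappa> using E(1) by (simp add: S_def)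
  have Scar: "c \<in> carrier G" if "c \<in> S \<kappa>" for c \<kappa> using that E(2) by (auto simp: S_def)

  \<comment> \<open>For \<open>g = f \<otimes> c\<close> the letter of the word at \<open>f\<close>
    is prescribed, as \<open>\<phi> g x\<close> equals \<open>\<phi> f (\<phi> c x)\<close>. Where
    tiles overlap, any of them will do.\<close>
  have "\<exists>U. U \<in> \<U> \<and> P \<kappa> \<subseteq> \<phi> g -` U" if "\<kappa> \<in> I" "g \<in> E - (E - Cov \<kappa>)" for \<kappa> g
  proof -
    have \<kappa>: "\<kappa> \<in> Q" using that by (simp add: I_def)
    have "g \<in> Cov \<kappa>" using that by blast
    then obtain c f where c: "c \<in> S \<kappa>" "f \<in> dom (the (\<kappa> c))" "g = f \<otimes> c"
      unfolding Cov_def tile_def by blast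
    let ?u = "the (\<kappa> c)"
    have u: "?u \<in> \<Lambda>" using in\<Lambda>[OF \<kappa> c(1)] .
    have "the (?u f) \<in> \<U>" using idx(4)[OF u] c(2) by (auto simp: ran_def)
    moreover have "\<phi> g x \<in> the (?u f)" if "x \<in> P \<kappa>" for x
    proof -
      have "\<phi> c x \<in> family_set \<phi> ?u" using that c(1) by (simp add: P_def)
      then have "\<phi> f (\<phi> c x) \<in> the (?u f)" using c(2) by (auto simp: family_set_def)
      then show ?thesis
        using action_mult[of f c x] domu(2)[OF u] c(2,3) Scar[OF c(1)] by (auto simp: subset_iff)
    qed
    ultimately show ?thesis by blast
  qed
  then obtain a where a: "\<And>\<kappa> g. \<kappa> \<in> I \<Longrightarrow> g \<in> E - (E - Cov \<kappa>) \<Longrightarrow> a \<kappa> g \<in> \<U> \<and> P \<kappa> \<subseteq> \<phi> g -` a \<kappa> g"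
    by metis

  have "\<exists>\<kappa>\<in>I. x \<in> P \<kappa>" for x
  proof -
    \<comment> \<open>Each \<open>\<phi> c x\<close> lies in a set of the Bowen cover; the index of
      its word decides which tile is offered at \<open>c\<close>.\<close>
    have "\<forall>c. \<exists>u\<in>\<Lambda>. \<phi> c x \<in> family_set \<phi> u" using cov by blast
    then obtain w where w: "\<And>c. w c \<in> \<Lambda>" "\<And>c. \<phi> c x \<in> family_set \<phi> (w c)" by metis
    obtain T where T: "T \<subseteq> A"
      "(1 - \<epsilon>) * (\<Sum>c\<in>T. real (card (F (idx (w c))))) \<le> real (card (\<Union>c\<in>T. (\<lambda>f. f \<otimes> c) ` F (idx (w c))))"
      "(1 - \<epsilon>) * real (card A) \<le> (C + 1 / \<epsilon>) * real (card (\<Union>c\<in>T. (\<lambda>f. f \<otimes> c) ` F (idx (w c))))"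
    proof (rule quasi_tiling[of A \<epsilon> F "\<lambda>c. idx (w c)" C])
      show "finite A" "A \<subseteq> carrier G" using E by (auto simp: A_def)
    qed (use eps F C idx(1) w(1) in auto)
    define \<kappa> where "\<kappa> = (\<lambda>c\<in>E. if c \<in> T then Some (w c) else None)"
    have TE: "T \<subseteq> E" using T(1) by (auto simp: A_def)
    have S\<kappa>: "S \<kappa> = T" using TE by (auto simp: S_def \<kappa>_def)
    have the\<kappa>: "the (\<kappa> c) = w c" if "c \<in> T" for c using that TE by (auto simp: \<kappa>_def)
    have Cov: "Cov \<kappa> = (\<Union>c\<in>T. (\<lambda>f. f \<otimes> c) ` F (idx (w c)))"
      unfolding Cov_def S\<kappa> tile_def using the\<kappa> idx(3)[OF w(1)] by auto
    have "\<kappa> \<in> Q" using w(1) by (auto simp: Q_def \<kappa>_def)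
    moreover have "Cov \<kappa> \<subseteq> E"
    proof
      fix g assume "g \<in> Cov \<kappa>"
      then obtain c f where c: "c \<in> T" "f \<in> F (idx (w c))" "g = f \<otimes> c" unfolding Cov by blast
      have "f \<in> D" using D(1)[OF w(1)] idx(3)[OF w(1)] c(2) by blast
      moreover have "c \<in> A" "c \<in> E" "c \<in> carrier G" using c(1) T(1) TE E(2) by auto
      ultimately show "g \<in> E" using c(3) by (auto simp: A_def boundary_def)
    qed
    moreover have "m \<kappa> = (\<Sum>c\<in>T. real (card (F (idx (w c)))))"
      unfolding m_def S\<kappa> using the\<kappa> idx(3)[OF w(1)] by (intro sum.cong) auto
    moreover have "\<gamma> * real (card A) \<le> real (card (Cov \<kappa>))"
    proof -
      have "(1 - \<epsilon>) * (\<gamma> * real (card A)) = \<gamma> * ((1 - \<epsilon>) * real (card A))" by simp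
      also have "\<dots> \<le> \<gamma> * ((C + 1 / \<epsilon>) * real (card (Cov \<kappa>)))"
        using T(3) \<gamma>(1) unfolding Cov by (intro mult_left_mono)
      also have "\<dots> = \<gamma> * (C + 1 / \<epsilon>) * real (card (Cov \<kappa>))" by simp
      also have "\<dots> \<le> (1 - \<epsilon>) * real (card (Cov \<kappa>))"
        using \<gamma>(2) by (intro mult_right_mono) auto
      finally show ?thesis using eps by simp
    qed
    ultimately have "\<kappa> \<in> I" using T(2) by (simp add: I_def Cov)
    moreover have "x \<in> P \<kappa>" using w(2) by (simp add: P_def S\<kappa> the\<kappa>)
    ultimately show ?thesis by blast
  qed
  then have "join_number \<U> E \<le> (\<Sum>\<kappa>\<in>I. join_number \<U> (E - Cov \<kappa>))"
    by (intro cover_number_join_le_sum[OF V E(1) finI Diff_subset a])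
  then have "real (join_number \<U> E) \<le> (\<Sum>\<kappa>\<in>I. real (join_number \<U> (E - Cov \<kappa>)))"
    unfolding of_nat_sum[symmetric] of_nat_le_iff .
  also have "\<dots> \<le> (\<Sum>\<kappa>\<in>I. exp (s / (1 - \<epsilon>) * real (card E) + K) *
      (\<Prod>c\<in>E. case \<kappa> c of None \<Rightarrow> 1 | Some u \<Rightarrow> exp (- s * real (card (dom u)))))"
  proof (rule sum_mono)
    fix \<kappa> assume "\<kappa> \<in> I"
    then have \<kappa>: "\<kappa> \<in> Q" "Cov \<kappa> \<subseteq> E" "(1 - \<epsilon>) * m \<kappa> \<le> real (card (Cov \<kappa>))"
      "\<gamma> * real (card A) \<le> real (card (Cov \<kappa>))"
      by (auto simp: I_def)
    have finC: "finite (Cov \<kappa>)" using \<kappa>(2) E(1) finite_subset by blast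
    have "card (E - Cov \<kappa>) = card E - card (Cov \<kappa>)" by (rule card_Diff_subset[OF finC \<kappa>(2)])
    then have cardR: "real (card (E - Cov \<kappa>)) = real (card E) - real (card (Cov \<kappa>))"
      using card_mono[OF E(1) \<kappa>(2)] by simp
    have "real (join_number \<U> (E - Cov \<kappa>)) \<le> exp (s / (1 - \<epsilon>) * real (card (E - Cov \<kappa>)) + K)"
    proof (rule rest)
      \<comment> \<open>Centres are lost only to the boundary of \<open>E\<close>, and the tiles
        cover at least \<open>\<gamma>\<close> times the number of those left.\<close>
      have "card E - card (boundary G D E) \<le> card A"
        unfolding A_def by (rule diff_card_le_card_Diff) (use finite_boundary D E in auto)
      then have "real (card E) - real (card (boundary G D E)) \<le> real (card A)" by linarith
      then have "\<gamma> * (real (card E) - real (card (boundary G D E))) \<le> \<gamma> * real (card A)"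
        using \<gamma>(1) by (rule mult_left_mono)
      also note \<kappa>(4)
      finally show "real (card (E - Cov \<kappa>)) \<le> (1 - \<gamma>) * real (card E) + \<gamma> * real (card (boundary G D E))"
        unfolding cardR by (simp add: algebra_simps)
      have tilecar: "tile \<kappa> c \<subseteq> carrier G" "finite (tile \<kappa> c)" if "c \<in> S \<kappa>" for c
        using domu[OF in\<Lambda>[OF \<kappa>(1) that]] Scar[OF that] by (auto simp: tile_def)
      \<comment> \<open>The remainder inherits its boundary from \<open>E\<close> and from the
        tiles; the latter have small boundaries relative to their own sizes, hence in total relative
        to \<open>m \<kappa>\<close>.\<close>
      have "boundary G D0 (E - Cov \<kappa>) \<subseteq> boundary G D0 E \<union> (\<Union>c\<in>S \<kappa>. boundary G D0 (tile \<kappa> c))"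
        unfolding Cov_def
        using boundary_Diff_subset[of G D0 E "\<Union>c\<in>S \<kappa>. tile \<kappa> c"] boundary_UN_subset[of G D0 "tile \<kappa>" "S \<kappa>"]
        by (meson Un_mono order_refl order_trans)
      then have "card (boundary G D0 (E - Cov \<kappa>)) \<le>
          card (boundary G D0 E \<union> (\<Union>c\<in>S \<kappa>. boundary G D0 (tile \<kappa> c)))"
        using finS tilecar E D0 by (intro card_mono finite_UnI finite_UN_I finite_boundary) auto
      also have "\<dots> \<le> card (boundary G D0 E) + card (\<Union>c\<in>S \<kappa>. boundary G D0 (tile \<kappa> c))"
        by (rule card_Un_le)
      also have "\<dots> \<le> card (boundary G D0 E) + (\<Sum>c\<in>S \<kappa>. card (boundary G D0 (tile \<kappa> c)))"
        using card_UN_le[OF finS] by (intro add_left_mono)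
      also have "\<dots> \<le> card (boundary G D0 E) + (\<Sum>c\<in>S \<kappa>. card (boundary G D0 (dom (the (\<kappa> c)))))"
        unfolding tile_def using domu[OF in\<Lambda>[OF \<kappa>(1)]] Scar D0
        by (intro add_left_mono sum_mono card_boundary_translate) auto
      finally have "real (card (boundary G D0 (E - Cov \<kappa>))) \<le>
          real (card (boundary G D0 E)) + (\<Sum>c\<in>S \<kappa>. real (card (boundary G D0 (dom (the (\<kappa> c))))))"
        unfolding of_nat_sum[symmetric] of_nat_add[symmetric] of_nat_le_iff .
      also have "(\<Sum>c\<in>S \<kappa>. real (card (boundary G D0 (dom (the (\<kappa> c)))))) \<le> \<eta> * m \<kappa>"
        unfolding m_def sum_distrib_left using idx in\<Lambda>[OF \<kappa>(1)] M by (intro sum_mono) auto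
      finally have "real (card (boundary G D0 (E - Cov \<kappa>))) - real (card (boundary G D0 E)) \<le> \<eta> * m \<kappa>"
        by simp
      then have "(1 - \<epsilon>) * (real (card (boundary G D0 (E - Cov \<kappa>))) - real (card (boundary G D0 E))) \<le>
          (1 - \<epsilon>) * (\<eta> * m \<kappa>)"
        using eps by (intro mult_left_mono) auto
      also have "\<dots> = \<eta> * ((1 - \<epsilon>) * m \<kappa>)" by simp
      also have "\<dots> \<le> \<eta> * real (card E)"
      proof (rule mult_left_mono)
        show "(1 - \<epsilon>) * m \<kappa> \<le> real (card E)"
          using \<kappa>(3) card_mono[OF E(1) \<kappa>(2)] by linarith
        have "0 \<le> \<eta> * real (card (F (max 1 M)))" using M[of "max 1 M"] by linarith
        then show "0 \<le> \<eta>" using F[of "max 1 M"] by (simp add: zero_le_mult_iff card_gt_0_iff)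
      qed
      finally show "(1 - \<epsilon>) * (real (card (boundary G D0 (E - Cov \<kappa>))) - real (card (boundary G D0 E))) \<le> \<eta> * real (card E)" .
    qed auto
    \<comment> \<open>Every covered point lowers the exponent by
      \<open>s / (1 - \<epsilon>)\<close>; as overlaps are small, this saves at least
      \<open>s * m \<kappa>\<close>, the negative logarithm of the product of the weights.\<close>
    also have "\<dots> \<le> exp (s / (1 - \<epsilon>) * real (card E) + K + (\<Sum>c\<in>S \<kappa>. - s * real (card (dom (the (\<kappa> c))))))"
    proof -
      have "s * m \<kappa> = s / (1 - \<epsilon>) * ((1 - \<epsilon>) * m \<kappa>)" using eps by simp
      also have "\<dots> \<le> s / (1 - \<epsilon>) * real (card (Cov \<kappa>))"
        using \<kappa>(3) \<open>0 \<le> s\<close> eps by (intro mult_left_mono) auto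
      finally have "s * m \<kappa> \<le> s / (1 - \<epsilon>) * real (card (Cov \<kappa>))" .
      moreover have "(\<Sum>c\<in>S \<kappa>. - s * real (card (dom (the (\<kappa> c))))) = - (s * m \<kappa>)"
        by (simp add: m_def sum_distrib_left sum_negf)
      ultimately show ?thesis
        unfolding cardR by (simp only: exp_le_cancel_iff right_diff_distrib)
    qed
    also have "\<dots> = exp (s / (1 - \<epsilon>) * real (card E) + K) *
        (\<Prod>c\<in>S \<kappa>. exp (- s * real (card (dom (the (\<kappa> c))))))"
      by (subst exp_add) (simp add: exp_sum finS)
    \<comment> \<open>With factor 1 for \<open>None\<close> the product runs over all of
      \<open>E\<close>, independently of \<open>\<kappa>\<close>, so the sum will factorise.\<close>
    also have "(\<Prod>c\<in>S \<kappa>. exp (- s * real (card (dom (the (\<kappa> c)))))) =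
        (\<Prod>c\<in>E. case \<kappa> c of None \<Rightarrow> 1 | Some u \<Rightarrow> exp (- s * real (card (dom u))))"
      by (rule prod.mono_neutral_cong_left) (use E(1) in \<open>auto simp: S_def\<close>)
    finally show "real (join_number \<U> (E - Cov \<kappa>)) \<le> exp (s / (1 - \<epsilon>) * real (card E) + K) *
        (\<Prod>c\<in>E. case \<kappa> c of None \<Rightarrow> 1 | Some u \<Rightarrow> exp (- s * real (card (dom u))))" .
  qed
  also have "\<dots> \<le> (\<Sum>\<kappa>\<in>Q. exp (s / (1 - \<epsilon>) * real (card E) + K) *
      (\<Prod>c\<in>E. case \<kappa> c of None \<Rightarrow> 1 | Some u \<Rightarrow> exp (- s * real (card (dom u)))))"
    by (intro sum_mono2 finQ mult_nonneg_nonneg prod_nonneg) (auto simp: I_def split: option.split)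
  \<comment> \<open>Distributivity: each point of \<open>E\<close> contributes the factor one plus
    the total weight of \<open>\<Lambda>\<close>, which is at most
    \<open>exp \<tau>\<close>.\<close>
  also have "\<dots> = exp (s / (1 - \<epsilon>) * real (card E) + K) *
      (\<Prod>c\<in>E. \<Sum>y\<in>insert None (Some ` \<Lambda>). case y of None \<Rightarrow> 1 | Some u \<Rightarrow> exp (- s * real (card (dom u))))"
    unfolding Q_def sum_distrib_left[symmetric] using E(1) fin\<Lambda> by (subst prod_sum_PiE) auto
  also have "(\<Sum>y\<in>insert None (Some ` \<Lambda>). case y of None \<Rightarrow> 1 | Some u \<Rightarrow> exp (- s * real (card (dom u)))) =
      1 + (\<Sum>u\<in>\<Lambda>. exp (- s * real (card (dom u))))"
    using fin\<Lambda> by (subst sum.insert) (auto simp: sum.reindex)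
  also have "exp (s / (1 - \<epsilon>) * real (card E) + K) * (\<Prod>c\<in>E. 1 + (\<Sum>u\<in>\<Lambda>. exp (- s * real (card (dom u))))) \<le>
      exp (s / (1 - \<epsilon>) * real (card E) + K) * (\<Prod>c\<in>E. exp \<tau>)"
  proof (intro mult_left_mono prod_mono conjI)
    have "1 + (\<Sum>u\<in>\<Lambda>. exp (- s * real (card (dom u)))) \<le> 1 + \<tau>" using wt by simp
    also have "\<dots> \<le> exp \<tau>" by (rule exp_ge_add_one_self)
    finally show "1 + (\<Sum>u\<in>\<Lambda>. exp (- s * real (card (dom u)))) \<le> exp \<tau>" .
    show "0 \<le> 1 + (\<Sum>u\<in>\<Lambda>. exp (- s * real (card (dom u))))" by (simp add: sum_nonneg)
  qed simp
  also have "\<dots> = exp ((s / (1 - \<epsilon>) + \<tau>) * real (card E) + K)"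
    by (simp add: algebra_simps flip: exp_of_nat_mult exp_add)
  finally show ?thesis .
qed

end

section \<open>Subsequences and growth of Foelner sequences\<close>

context group
begin

lemma folner_subseq:
  assumes "folner_seq G F" "strict_mono r"
  shows "folner_seq G (F \<circ> r)"
proof -
  have "1 \<le> r n" if "1 \<le> n" for n
    using that seq_suble[OF assms(2), of n] by linarith
  moreover have "(\<lambda>n. real (card (sym_diff (F (r n)) (g <#\<^bsub>G\<^esub> F (r n)))) / real (card (F (r n)))) \<longlonglongrightarrow> 0"
    if "g \<in> carrier G" for g
    using LIMSEQ_subseq_LIMSEQ[OF _ assms(2)] assms(1) that
    by (fastforce simp: folner_seq_def o_def)
  ultimately show ?thesis using assms(1) by (simp add: folner_seq_def)
qed

text \<open>\<open>B <#> F n\<close> exceeds \<open>F n\<close> only by boundary points for the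
  inverses of \<open>B\<close>; the factor 2 is one plus the relative boundary bound 1.\<close>

lemma folner_eventually_card_mult_le:
  assumes F: "folner_seq G F" and B: "finite B" "B \<subseteq> carrier G"
  shows "\<forall>\<^sub>F n in sequentially. card (B <#> F n) \<le> 2 * card (F n)"
proof -
  have D: "finite (m_inv G ` B)" "m_inv G ` B \<subseteq> carrier G" using B by auto
  show ?thesis
    using folner_boundary[OF F D zero_less_one] eventually_ge_at_top[of 1]
  proof eventually_elim
    case (elim n)
    have Fn: "finite (F n)" "F n \<subseteq> carrier G"
      using F elim by (auto simp: folner_seq_def)
    have "B <#> F n \<subseteq> F n \<union> boundary G (m_inv G ` B) (F n)"
    proof
      fix c assume "c \<in> B <#> F n"
      then obtain b f where b: "b \<in> B" "f \<in> F n" "c = b \<otimes> f" by (auto simp: set_mult_def)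
      then have "b \<in> carrier G" "f \<in> carrier G" using B Fn by auto
      then have "inv b \<otimes> c = f" "c \<in> carrier G" using b(3) by (simp_all flip: m_assoc)
      then show "c \<in> F n \<union> boundary G (m_inv G ` B) (F n)" using b by (auto simp: boundary_def)
    qed
    then have "card (B <#> F n) \<le> card (F n \<union> boundary G (m_inv G ` B) (F n))"
      using Fn D by (intro card_mono finite_UnI finite_boundary)
    also have "\<dots> \<le> card (F n) + card (boundary G (m_inv G ` B) (F n))" by (rule card_Un_le)
    finally show ?case using elim by simp
  qed
qed

text \<open>Once \<open>r n\<close> is chosen, the next index is taken so large that multiplication
  by all earlier inverses at most doubles the new set.\<close>

lemma folner_tempered_subseq:
  assumes F: "folner_seq G F"
  obtains r :: "nat \<Rightarrow> nat" where "strict_mono r" "tempered G (F \<circ> r)"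
proof -
  define B where "B = (\<lambda>m. \<Union>k\<in>{1..m}. set_inv (F k))"
  have "finite (F k)" "F k \<subseteq> carrier G" if "1 \<le> k" for k
    using F that by (auto simp: folner_seq_def)
  then have B: "finite (B m)" "B m \<subseteq> carrier G" for m
    by (auto simp: B_def SET_INV_def subset_iff)
  have "\<exists>y. True \<and> (x < y \<and> card (B x <#> F y) \<le> 2 * card (F y))" for x
    using eventually_conj[OF eventually_gt_at_top[of x] folner_eventually_card_mult_le[OF F B, of x]]
    by (auto dest: eventually_happens)
  then have "\<exists>r. \<forall>n. True \<and> (r n < r (Suc n) \<and> card (B (r n) <#> F (r (Suc n))) \<le> 2 * card (F (r (Suc n))))"
    by (intro dependent_nat_choice[where Q = "\<lambda>n x y. x < y \<and> card (B x <#> F y) \<le> 2 * card (F y)"]) auto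
  then obtain r where r: "\<And>n. r n < r (Suc n)"
    "\<And>n. card (B (r n) <#> F (r (Suc n))) \<le> 2 * card (F (r (Suc n)))"
    by auto
  have mono: "strict_mono r" using r(1) by (simp add: strict_mono_Suc_iff)
  have "real (card (\<Union>k\<in>{1..<n}. set_inv (F (r k)) <#> F (r n))) \<le> 2 * real (card (F (r n)))" if n: "1 \<le> n" for n
  proof -
    obtain p where p: "n = Suc p" using n by (cases n) auto
    have "set_inv (F (r k)) \<subseteq> B (r p)" if "k \<in> {1..<n}" for k
    proof -
      \<comment> \<open>\<open>B\<close> starts at index 1, the value of \<open>F\<close> at 0 being
        meaningless.\<close>
      have "1 \<le> r k" using that seq_suble[OF mono, of k] by simp
      moreover have "r k \<le> r p" using that p mono by (simp add: strict_mono_less_eq)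
      ultimately show ?thesis by (auto simp: B_def)
    qed
    then have "(\<Union>k\<in>{1..<n}. set_inv (F (r k)) <#> F (r n)) \<subseteq> B (r p) <#> F (r n)"
      by (fastforce simp: set_mult_def)
    moreover have "finite (B (r p) <#> F (r n))"
    proof -
      have "finite (F (r n))" using F n seq_suble[OF mono, of n] by (simp add: folner_seq_def)
      then show ?thesis using B by (auto simp: set_mult_def)
    qed
    ultimately have "card (\<Union>k\<in>{1..<n}. set_inv (F (r k)) <#> F (r n)) \<le> card (B (r p) <#> F (r n))"
      by (intro card_mono)
    also have "\<dots> \<le> 2 * card (F (r n))" using r(2)[of p] p by simp
    finally show ?thesis by linarith
  qed
  then have "tempered G (F \<circ> r)"
    unfolding tempered_def comp_def by blast
  with mono show ?thesis by (rule that)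
qed

text \<open>If \<open>b + 1\<close> group elements produce no boundary, they move any point of
  \<open>F n\<close> to \<open>b + 1\<close> distinct points of \<open>F n\<close>.\<close>

lemma folner_card_at_top:
  assumes F: "folner_seq G F" and "infinite (carrier G)"
  shows "filterlim (\<lambda>n. card (F n)) at_top sequentially"
  unfolding filterlim_at_top
proof
  fix b :: nat
  obtain D where D: "D \<subseteq> carrier G" "card D = b + 1" "finite D"
    using infinite_arbitrarily_large[OF \<open>infinite (carrier G)\<close>] by metis
  \<comment> \<open>With this constant, \<open>card (F n) < b\<close> would allow fewer than one
    boundary point, hence none.\<close>
  have "1 / (2 * (real b + 1)) > 0" by simp
  from folner_boundary[OF F D(3,1) this] eventually_ge_at_top[of 1]
  show "\<forall>\<^sub>F n in sequentially. b \<le> card (F n)"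
  proof eventually_elim
    case (elim n)
    have Fn: "finite (F n)" "F n \<noteq> {}" "F n \<subseteq> carrier G"
      using F elim by (auto simp: folner_seq_def)
    show ?case
    proof (rule ccontr)
      assume "\<not> b \<le> card (F n)"
      then have "1 / (2 * (real b + 1)) * real (card (F n)) < 1" by (simp add: field_simps)
      with elim have "card (boundary G D (F n)) = 0" by linarith
      then have "boundary G D (F n) = {}" using finite_boundary D Fn by simp
      moreover obtain f where f: "f \<in> F n" using Fn by auto
      ultimately have "(\<lambda>g. g \<otimes> f) ` D \<subseteq> F n" using Fn by (auto simp: boundary_def)
      then have "card ((\<lambda>g. g \<otimes> f) ` D) \<le> card (F n)" using Fn by (intro card_mono)
      moreover have "card ((\<lambda>g. g \<otimes> f) ` D) = card D" using f Fn D by (intro card_translate) auto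
      ultimately show False using D(2) \<open>\<not> b \<le> card (F n)\<close> by simp
    qed
  qed
qed

end

section \<open>Iterating the counting step\<close>

context compact_action
begin

text \<open>For negative \<open>s\<close> every word weighs at least 1, and a cover of an inhabited
  space is not empty.\<close>

lemma bowen_M_eq_0_nonneg:
  assumes "open_cover \<U>" and F: "folner_seq G F" and "bowen_M \<phi> F UNIV \<U> s = 0"
  shows "0 \<le> s"
proof (rule ccontr)
  assume "\<not> 0 \<le> s"
  have F': "finite (F n) \<and> F n \<subseteq> carrier G" if "1 \<le> n" for n
    using F that by (simp add: folner_seq_def)
  obtain \<Lambda> where L: "finite \<Lambda>" "\<Lambda> \<subseteq> (\<Union>j\<in>{j. 1 \<le> j \<and> 0 \<le> j}. families \<U> (F j))"
    "\<forall>x. \<exists>u\<in>\<Lambda>. x \<in> family_set \<phi> u" "(\<Sum>u\<in>\<Lambda>. exp (- s * real (card (dom u)))) < 1"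
    by (rule bowen_M_eq_0_finite_cover[OF assms(3) compact_UNIV assms(1) F' action_continuous zero_less_one, of 0])
  obtain u where u: "u \<in> \<Lambda>" using L(3) by blast
  have "1 \<le> exp (- s * real (card (dom u)))" using \<open>\<not> 0 \<le> s\<close> by (simp add: mult_nonpos_nonneg)
  also have "\<dots> \<le> (\<Sum>u\<in>\<Lambda>. exp (- s * real (card (dom u))))"
    using u L(1) by (intro member_le_sum) auto
  finally show False using L(4) by simp
qed

text \<open>After \<open>k\<close> rounds about the proportion \<open>(1 - \<gamma>) ^ k\<close> is
  uncovered and is charged the trivial rate \<open>ln (real (card \<V>))\<close>. \<open>T\<close>
  is a scale common to all rounds: remainders may become small, so errors are measured against the
  original size. \<open>\<delta>\<close> varies in the induction because each round spends a part of
  it.\<close>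

lemma join_number_iterated_bound:
  assumes V: "\<V> \<subseteq> \<U>" "finite \<V>" "\<Union>\<V> = UNIV" and "open_cover \<U>"
    and F: "folner_seq G F"
    and C: "\<And>n. 1 \<le> n \<Longrightarrow>
      real (card (\<Union>k\<in>{1..<n}. set_inv (F k) <#> F n)) \<le> C * real (card (F n))"
    and M0: "bowen_M \<phi> F UNIV \<U> s = 0"
    and eps: "0 < \<epsilon>" "\<epsilon> < 1"
    and \<gamma>: "0 \<le> \<gamma>" "\<gamma> \<le> 1" "\<gamma> * (C + 1 / \<epsilon>) \<le> 1 - \<epsilon>"
    and "\<delta> > 0"
  shows "\<exists>D \<eta>. finite D \<and> D \<subseteq> carrier G \<and> 0 < \<eta> \<and>
    (\<forall>E T. finite E \<and> E \<subseteq> carrier G \<and> real (card E) \<le> T \<and>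
        real (card (boundary G D E)) \<le> \<eta> * T \<longrightarrow>
      real (join_number \<U> E) \<le>
        exp ((s / (1 - \<epsilon>) + (1 - \<gamma>) ^ k * ln (real (card \<V>))) * real (card E) + \<delta> * T))"
  using \<open>\<delta> > 0\<close>
proof (induction k arbitrary: \<delta>)
  have s: "0 \<le> s" by (rule bowen_M_eq_0_nonneg[OF assms(4) F M0])
  have "\<V> \<noteq> {}" using V(3) by auto
  then have cV: "1 \<le> card \<V>" using V(2) by (simp add: Suc_le_eq card_gt_0_iff)
  {
    case 0
    show ?case
    proof (intro exI[of _ "{}"] exI[of _ 1] conjI allI impI)
      fix E :: "'a set" and T :: real
      assume a: "finite E \<and> E \<subseteq> carrier G \<and> real (card E) \<le> T \<and> real (card (boundary G {} E)) \<le> 1 * T"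
      have "real (join_number \<U> E) \<le> real (card \<V> ^ card E)"
        using cover_number_join_bounds(2)[OF V, of E \<phi>] a of_nat_le_iff by blast
      also have "\<dots> = exp (ln (real (card \<V>)) * real (card E))"
        using cV by (simp add: exp_of_nat2_mult)
      also have "\<dots> \<le> exp ((s / (1 - \<epsilon>) + (1 - \<gamma>) ^ 0 * ln (real (card \<V>))) * real (card E) + \<delta> * T)"
      proof -
        have "0 \<le> s / (1 - \<epsilon>) * real (card E)" using s eps by simp
        moreover have "0 \<le> \<delta> * T" using a 0 by (meson less_imp_le mult_nonneg_nonneg of_nat_0_le_iff order_trans)
        ultimately show ?thesis by (simp add: algebra_simps)
      qed
      finally show "real (join_number \<U> E) \<le>
        exp ((s / (1 - \<epsilon>) + (1 - \<gamma>) ^ 0 * ln (real (card \<V>))) * real (card E) + \<delta> * T)" .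
    qed auto
  next
    case (Suc k)
    define L where "L = ln (real (card \<V>))"
    define q where "q = 1 - \<gamma>"
    have L: "0 \<le> L" using cV by (simp add: L_def)
    have q: "0 \<le> q" "q \<le> 1" using \<gamma> by (auto simp: q_def)
    have d3: "\<delta> / 3 > 0" using Suc.prems by simp
    from Suc.IH[OF d3] obtain D0 \<eta>0 where D0: "finite D0" "D0 \<subseteq> carrier G" "0 < \<eta>0"
      and IH: "\<forall>E T. finite E \<and> E \<subseteq> carrier G \<and> real (card E) \<le> T \<and>
        real (card (boundary G D0 E)) \<le> \<eta>0 * T \<longrightarrow>
        real (join_number \<U> E) \<le> exp ((s / (1 - \<epsilon>) + q ^ k * L) * real (card E) + \<delta> / 3 * T)"
      unfolding L_def[symmetric] q_def[symmetric] by (elim exE conjE)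
    \<comment> \<open>The factor \<open>1 - \<epsilon>\<close> cancels against the one in the
      boundary estimate of a round; tiles may then use half of \<open>\<eta>0\<close> and the
      boundary of \<open>E\<close> the other half.\<close>
    define \<eta>1 where "\<eta>1 = (1 - \<epsilon>) * \<eta>0 / 2"
    have "\<eta>1 > 0" using D0 eps by (simp add: \<eta>1_def)
    \<comment> \<open>Tiles of this round are taken so late that they are nearly invariant under
      \<open>D0\<close>, the shape of the remaining rounds. Hence larger tiles come first.\<close>
    from folner_boundary[OF F D0(1,2) this]
    obtain M where M: "\<And>n. M \<le> n \<Longrightarrow> real (card (boundary G D0 (F n))) \<le> \<eta>1 * real (card (F n))"
      by (auto simp: eventually_sequentially)
    have F': "finite (F n) \<and> F n \<noteq> {} \<and> F n \<subseteq> carrier G" if "1 \<le> n" for n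
      using F that by (simp add: folner_seq_def)
    then have F'': "finite (F n) \<and> F n \<subseteq> carrier G" if "1 \<le> n" for n
      using that by blast
    obtain \<Lambda> where \<Lambda>: "finite \<Lambda>" "\<Lambda> \<subseteq> (\<Union>j\<in>{j. 1 \<le> j \<and> M \<le> j}. families \<U> (F j))"
      "\<forall>x. \<exists>u\<in>\<Lambda>. x \<in> family_set \<phi> u" "(\<Sum>u\<in>\<Lambda>. exp (- s * real (card (dom u)))) < \<delta> / 3"
      by (rule bowen_M_eq_0_finite_cover[OF M0 compact_UNIV assms(4) F'' action_continuous d3, of M])
    \<comment> \<open>\<open>D0\<close> controls the boundary inherited from \<open>E\<close>; the
      domains of the words let tiles stay inside \<open>E\<close>.\<close>
    define D where "D = D0 \<union> (\<Union>u\<in>\<Lambda>. dom u)"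
    have "finite (dom u) \<and> dom u \<subseteq> carrier G" if "u \<in> \<Lambda>" for u
    proof -
      obtain j where "1 \<le> j" "dom u = F j" using \<Lambda>(2) \<open>u \<in> \<Lambda>\<close> by (auto simp: families_def)
      then show ?thesis using F'' by simp
    qed
    then have D: "finite D" "D \<subseteq> carrier G" using D0 \<Lambda>(1) by (auto simp: D_def)
    \<comment> \<open>The second bound makes boundary points, charged at rate \<open>L\<close>, cost
      at most \<open>\<delta> / 3 * T\<close>; \<open>L + 1\<close> avoids division by zero.\<close>
    define \<eta> where "\<eta> = min (\<eta>0 / 2) (\<delta> / (3 * (L + 1)))"
    have \<eta>: "0 < \<eta>" using D0 L Suc.prems by (simp add: \<eta>_def)
    have \<eta>_le: "\<eta> \<le> \<eta>0 / 2" "\<eta> \<le> \<delta> / (3 * (L + 1))" unfolding \<eta>_def by (rule min.cobounded1, rule min.cobounded2)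
    have L\<eta>: "L * \<eta> \<le> \<delta> / 3"
    proof -
      have "(L + 1) * \<eta> \<le> (L + 1) * (\<delta> / (3 * (L + 1)))"
        using L \<eta>_le(2) by (intro mult_left_mono) auto
      also have "\<dots> = \<delta> / 3" using L by (simp add: field_simps)
      finally show ?thesis using \<eta> by (simp add: algebra_simps)
    qed
    show ?case
    proof (intro exI[of _ D] exI[of _ \<eta>] conjI allI impI)
      fix E T
      assume "finite E \<and> E \<subseteq> carrier G \<and> real (card E) \<le> T \<and> real (card (boundary G D E)) \<le> \<eta> * T"
      then have E: "finite E" "E \<subseteq> carrier G" and T: "real (card E) \<le> T"
        and bd: "real (card (boundary G D E)) \<le> \<eta> * T" by auto
      have T0: "0 \<le> T" using T by linarith
      \<comment> \<open>Of the two thirds of \<open>\<delta>\<close>, one comes from the induction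
        hypothesis and one from boundary points; the last third is the weight of
        \<open>\<Lambda>\<close>.\<close>
      define K where "K = q ^ Suc k * L * real (card E) + 2 * \<delta> / 3 * T"
      have "real (join_number \<U> E) \<le> exp ((s / (1 - \<epsilon>) + \<delta> / 3) * real (card E) + K)"
      proof (rule join_number_quasi_tiling[OF V F' C eps s \<Lambda>(1,2) spec[OF \<Lambda>(3)] _ E _ D D0(1,2) M \<gamma>(1,3)])
        show "(\<Sum>u\<in>\<Lambda>. exp (- s * real (card (dom u)))) \<le> \<delta> / 3" using \<Lambda>(4) by simp
        show "dom u \<subseteq> D" if "u \<in> \<Lambda>" for u using that by (auto simp: D_def)
        fix R
        assume R: "R \<subseteq> E"
          and cR: "real (card R) \<le> (1 - \<gamma>) * real (card E) + \<gamma> * real (card (boundary G D E))"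
          and bR: "(1 - \<epsilon>) * (real (card (boundary G D0 R)) - real (card (boundary G D0 E))) \<le> \<eta>1 * real (card E)"
        have "real (card R) \<le> T" using card_mono[OF E(1) R] T by linarith
        moreover have "real (card (boundary G D0 R)) \<le> \<eta>0 * T"
        proof -
          have "card (boundary G D0 E) \<le> card (boundary G D E)"
            using boundary_mono[of D0 D G E] finite_boundary D E by (intro card_mono) (auto simp: D_def)
          then have "real (card (boundary G D0 E)) \<le> \<eta> * T" using bd by linarith
          also have "\<dots> \<le> \<eta>0 / 2 * T" using T0 \<eta>_le(1) by (intro mult_right_mono)
          finally have 1: "real (card (boundary G D0 E)) \<le> \<eta>0 / 2 * T" .
          have "\<eta>1 * real (card E) \<le> \<eta>1 * T" using T \<open>\<eta>1 > 0\<close> by (intro mult_left_mono) auto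
          with bR have "(1 - \<epsilon>) * (real (card (boundary G D0 R)) - real (card (boundary G D0 E))) \<le>
              (1 - \<epsilon>) * (\<eta>0 / 2 * T)"
            by (simp add: \<eta>1_def)
          then have "real (card (boundary G D0 R)) - real (card (boundary G D0 E)) \<le> \<eta>0 / 2 * T"
            using eps by simp
          then show ?thesis using 1 by simp
        qed
        ultimately have "real (join_number \<U> R) \<le> exp ((s / (1 - \<epsilon>) + q ^ k * L) * real (card R) + \<delta> / 3 * T)"
          using R E finite_subset[OF R] by (intro IH[rule_format]) auto
        also have "\<dots> \<le> exp (s / (1 - \<epsilon>) * real (card R) + K)"
        proof -
          have "\<gamma> * real (card (boundary G D E)) \<le> 1 * (\<eta> * T)"
            using \<gamma> bd by (intro mult_mono) auto
          with cR have "real (card R) \<le> q * real (card E) + \<eta> * T" by (simp add: q_def)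
          then have "q ^ k * L * real (card R) \<le> q ^ k * L * (q * real (card E) + \<eta> * T)"
            using q L by (intro mult_left_mono) auto
          also have "\<dots> = q ^ Suc k * L * real (card E) + q ^ k * (L * \<eta> * T)"
            by (simp add: algebra_simps)
          also have "q ^ k * (L * \<eta> * T) \<le> 1 * (\<delta> / 3 * T)"
            using q L \<eta> T0 L\<eta> Suc.prems by (intro mult_mono power_le_one) auto
          finally show ?thesis by (simp add: K_def algebra_simps)
        qed
        finally show "real (join_number \<U> R) \<le> exp (s / (1 - \<epsilon>) * real (card R) + K)" .
      qed
      also have "\<dots> \<le> exp ((s / (1 - \<epsilon>) + q ^ Suc k * L) * real (card E) + \<delta> * T)"
      proof -
        have "\<delta> / 3 * real (card E) \<le> \<delta> / 3 * T" using T d3 by (intro mult_left_mono) auto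
        then show ?thesis by (simp add: K_def algebra_simps)
      qed
      finally show "real (join_number \<U> E) \<le>
        exp ((s / (1 - \<epsilon>) + (1 - \<gamma>) ^ Suc k * ln (real (card \<V>))) * real (card E) + \<delta> * T)"
        unfolding q_def L_def .
    qed (use D \<eta> in auto)
  }
qed

text \<open>The Bowen hypothesis concerns the tempered \<open>F\<close>, the conclusion any Foelner
  sequence \<open>F'\<close>, whose late members are invariant enough. \<open>\<delta>\<close> is
  shared in thirds by overlaps, uncovered points and accumulated errors.\<close>

lemma eventually_ln_join_number_le:
  assumes \<U>: "open_cover \<U>" and F: "folner_seq G F" and "tempered G F"
    and M0: "bowen_M \<phi> F UNIV \<U> s = 0" and F': "folner_seq G F'" and "\<delta> > 0"
  shows "\<forall>\<^sub>F n in sequentially. ln (real (join_number \<U> (F' n))) \<le> (s + \<delta>) * real (card (F' n))"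
proof -
  obtain \<V> where V: "\<V> \<subseteq> \<U>" "finite \<V>" "\<Union>\<V> = UNIV"
    by (rule open_cover_finite_subcover[OF \<U>])
  have s: "0 \<le> s" by (rule bowen_M_eq_0_nonneg[OF \<U> F M0])
  obtain C where C: "\<And>n. 1 \<le> n \<Longrightarrow>
      real (card (\<Union>k\<in>{1..<n}. set_inv (F k) <#> F n)) \<le> C * real (card (F n))"
    using \<open>tempered G F\<close> unfolding tempered_def by blast
  have "0 \<le> C * real (card (F 1))" using C[of 1] by simp
  then have C0: "0 \<le> C" using F by (simp add: zero_le_mult_iff folner_seq_def card_gt_0_iff)
  \<comment> \<open>\<open>\<delta> / (3 * s + \<delta>)\<close> would make
    \<open>s / (1 - \<epsilon>)\<close> equal to \<open>s + \<delta> / 3\<close> for positive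
    \<open>s\<close>; doubling \<open>\<delta>\<close> below keeps \<open>\<epsilon> < 1\<close>
    also for \<open>s = 0\<close>.\<close>
  define \<epsilon> where "\<epsilon> = \<delta> / (3 * s + 2 * \<delta>)"
  have pos: "3 * s + 2 * \<delta> > 0" using s \<open>\<delta> > 0\<close> by simp
  have eps: "0 < \<epsilon>" "\<epsilon> < 1" using pos s \<open>\<delta> > 0\<close> by (auto simp: \<epsilon>_def)
  have s': "s / (1 - \<epsilon>) \<le> s + \<delta> / 3"
  proof -
    have "\<epsilon> * (3 * s + 2 * \<delta>) = \<delta>" using pos by (simp add: \<epsilon>_def)
    moreover have "0 \<le> \<epsilon> * \<delta>" using eps \<open>\<delta> > 0\<close> by simp
    ultimately have "s \<le> (s + \<delta> / 3) * (1 - \<epsilon>)" by (simp add: algebra_simps)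
    then show ?thesis using eps by (simp add: pos_divide_le_eq)
  qed
  \<comment> \<open>The largest proportion that the quasi-tiling guarantees; its strict positivity
    drives the uncovered part to 0.\<close>
  define \<gamma> where "\<gamma> = (1 - \<epsilon>) / (C + 1 / \<epsilon>)"
  have ge1: "1 \<le> C + 1 / \<epsilon>" using C0 eps by (simp add: add_nonneg_pos add_increasing)
  then have \<gamma>: "0 < \<gamma>" "\<gamma> \<le> 1" "\<gamma> * (C + 1 / \<epsilon>) \<le> 1 - \<epsilon>"
    using eps by (auto simp: \<gamma>_def)
  have "(\<lambda>k. (1 - \<gamma>) ^ k * ln (real (card \<V>))) \<longlonglongrightarrow> 0"
    using \<gamma> by (intro tendsto_mult_left_zero LIMSEQ_realpow_zero) auto
  then have "\<forall>\<^sub>F k in sequentially. (1 - \<gamma>) ^ k * ln (real (card \<V>)) < \<delta> / 3"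
    using \<open>\<delta> > 0\<close> by (intro order_tendstoD(2)) auto
  then obtain k where k: "(1 - \<gamma>) ^ k * ln (real (card \<V>)) < \<delta> / 3"
    by (auto dest: eventually_happens)
  have d3: "\<delta> / 3 > 0" using \<open>\<delta> > 0\<close> by simp
  have "\<exists>D \<eta>. finite D \<and> D \<subseteq> carrier G \<and> 0 < \<eta> \<and>
    (\<forall>E T. finite E \<and> E \<subseteq> carrier G \<and> real (card E) \<le> T \<and>
        real (card (boundary G D E)) \<le> \<eta> * T \<longrightarrow>
      real (join_number \<U> E) \<le>
        exp ((s / (1 - \<epsilon>) + (1 - \<gamma>) ^ k * ln (real (card \<V>))) * real (card E) + \<delta> / 3 * T))"
    by (rule join_number_iterated_bound[OF V \<U> F C M0 eps less_imp_le[OF \<gamma>(1)] \<gamma>(2,3) d3])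
  then obtain D \<eta> where D: "finite D" "D \<subseteq> carrier G" "0 < \<eta>"
    and bound: "\<forall>E T. finite E \<and> E \<subseteq> carrier G \<and> real (card E) \<le> T \<and>
      real (card (boundary G D E)) \<le> \<eta> * T \<longrightarrow>
      real (join_number \<U> E) \<le>
        exp ((s / (1 - \<epsilon>) + (1 - \<gamma>) ^ k * ln (real (card \<V>))) * real (card E) + \<delta> / 3 * T)"
    by (elim exE conjE)
  show ?thesis
    using folner_boundary[OF F' D] eventually_ge_at_top[of 1]
  proof eventually_elim
    case (elim n)
    have Fn: "finite (F' n)" "F' n \<subseteq> carrier G"
      using F' elim by (auto simp: folner_seq_def)
    let ?c = "real (card (F' n))"
    have "real (join_number \<U> (F' n)) \<le>
        exp ((s / (1 - \<epsilon>) + (1 - \<gamma>) ^ k * ln (real (card \<V>))) * ?c + \<delta> / 3 * ?c)"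
      using bound Fn elim(1) by blast
    also have "\<dots> \<le> exp ((s + \<delta>) * ?c)"
    proof -
      have "(s / (1 - \<epsilon>) + (1 - \<gamma>) ^ k * ln (real (card \<V>)) + \<delta> / 3) * ?c \<le> (s + \<delta>) * ?c"
        using s' k by (intro mult_right_mono) auto
      then show ?thesis by (simp add: algebra_simps)
    qed
    finally have "real (join_number \<U> (F' n)) \<le> exp ((s + \<delta>) * ?c)" .
    moreover have "0 < real (join_number \<U> (F' n))"
      using cover_number_join_bounds(1)[OF V Fn(1), of \<phi>] by simp
    ultimately show ?case by (metis exp_gt_zero ln_exp ln_le_cancel_iff)
  qed
qed

end

section \<open>Equality of the two entropies\<close>

context compact_action
begin

text \<open>By \<open>upper\<close>, a vanishing Bowen measure along one tempered sequence bounds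
  the ratios along every Foelner sequence; by \<open>lower\<close>, ratios that are small infinitely
  often make the measure along their own sequence vanish. Together they pin \<open>r F\<close> to
  the infimum \<open>h\<close>; other sequences are compared through tempered subsequences.\<close>

lemma join_entropy_limit:
  assumes \<U>: "open_cover \<U>" and F: "folner_seq G F" "tempered G F" and inf: "infinite (carrier G)"
  obtains h where "bowen_cover_entropy \<phi> F UNIV \<U> = ereal h"
    "\<And>F'. folner_seq G F' \<Longrightarrow>
      (\<lambda>n. ln (real (join_number \<U> (F' n))) / real (card (F' n))) \<longlonglongrightarrow> h"
proof -
  obtain \<V> where V: "\<V> \<subseteq> \<U>" "finite \<V>" "\<Union>\<V> = UNIV"
    by (rule open_cover_finite_subcover[OF \<U>])
  have "\<V> \<noteq> {}" using V(3) by auto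
  then have cV: "1 \<le> card \<V>" using V(2) by (simp add: Suc_le_eq card_gt_0_iff)
  define r where "r = (\<lambda>(F :: nat \<Rightarrow> 'a set) n. ln (real (join_number \<U> (F n))) / real (card (F n)))"
  have fin: "finite (F' n)" if "folner_seq G F'" "1 \<le> n" for F' and n :: nat
    using that by (simp add: folner_seq_def)
  have r_le: "r F' n \<le> b \<longleftrightarrow> ln (real (join_number \<U> (F' n))) \<le> b * real (card (F' n))"
    if "folner_seq G F'" "1 \<le> n" for F' n b
  proof -
    have "real (card (F' n)) > 0" using that by (simp add: folner_seq_def card_gt_0_iff)
    then show ?thesis by (simp add: r_def pos_divide_le_eq)
  qed
  have upper: "\<forall>\<^sub>F n in sequentially. r F' n < s + \<delta>"
    if "folner_seq G K" "tempered G K" "bowen_M \<phi> K UNIV \<U> s = 0" "folner_seq G F'" "\<delta> > 0"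
    for K F' s \<delta>
  proof -
    have "\<delta> / 2 > 0" using that by simp
    from eventually_ln_join_number_le[OF \<U> that(1-4) this] eventually_ge_at_top[of 1]
    show ?thesis
    proof eventually_elim
      case (elim n)
      then have "r F' n \<le> s + \<delta> / 2" using r_le[OF that(4)] by blast
      then show ?case using \<open>\<delta> > 0\<close> by simp
    qed
  qed
  have lower: "bowen_M \<phi> K UNIV \<U> s = 0"
    if "folner_seq G K" "\<exists>\<^sub>F n in sequentially. r K n \<le> b" "b < s" for K s b
  proof (rule bowen_M_eq_0I[OF _ V folner_card_at_top[OF that(1) inf] _ that(3)])
    have "\<exists>\<^sub>F n in sequentially. r K n \<le> b \<and> 1 \<le> n"
      using that(2) eventually_ge_at_top[of 1] by (rule frequently_eventually_frequently)
    then show "\<exists>\<^sub>F n in sequentially. ln (real (join_number \<U> (K n))) \<le> b * real (card (K n))"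
      by (rule frequently_elim1) (use r_le[OF that(1)] in blast)
  qed (use fin that in auto)
  define S where "S = {s. bowen_M \<phi> F UNIV \<U> s = 0}"
  have bdd: "bdd_below S"
    using bowen_M_eq_0_nonneg[OF \<U> F(1)] by (intro bdd_belowI[of _ 0]) (auto simp: S_def)
  \<comment> \<open>The trivial word count shows that \<open>S\<close> is inhabited, so its infimum
    is a genuine real number.\<close>
  have "\<forall>\<^sub>F n in sequentially. r F n \<le> ln (real (card \<V>))"
    using eventually_ge_at_top[of 1]
  proof eventually_elim
    case (elim n)
    note b = cover_number_join_bounds[OF V fin[OF F(1) elim], of \<phi>]
    have "ln (real (join_number \<U> (F n))) \<le> ln (real (card \<V> ^ card (F n)))"
    proof (rule ln_mono)
      show "0 < real (join_number \<U> (F n))" using b(1) by simp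
      show "real (join_number \<U> (F n)) \<le> real (card \<V> ^ card (F n))" using b(2) by (rule of_nat_mono)
    qed
    also have "\<dots> = ln (real (card \<V>)) * real (card (F n))"
      using cV by (simp add: ln_realpow)
    finally show ?case by (simp add: r_le[OF F(1) elim])
  qed
  then have "\<exists>\<^sub>F n in sequentially. r F n \<le> ln (real (card \<V>))"
    by (intro eventually_frequently) auto
  then have "ln (real (card \<V>)) + 1 \<in> S" unfolding S_def using lower[OF F(1)] by simp
  then have ne: "S \<noteq> {}" by auto
  define h where "h = Inf S"
  have above: "\<forall>\<^sub>F n in sequentially. r F' n < a" if F': "folner_seq G F'" and "h < a" for F' a
  proof -
    obtain s where s: "s \<in> S" "s < a"
      using \<open>h < a\<close> ne bdd unfolding h_def by (auto simp: cInf_less_iff)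
    then show ?thesis using upper[OF F, of s F' "a - s"] F' by (simp add: S_def)
  qed
  have limF: "r F \<longlonglongrightarrow> h"
  proof (rule order_tendstoI)
    fix a assume "a < h"
    show "\<forall>\<^sub>F n in sequentially. a < r F n"
    proof (rule ccontr)
      assume "\<not> ?thesis"
      then have "\<exists>\<^sub>F n in sequentially. r F n \<le> a" by (simp add: frequently_def not_le)
      from lower[OF F(1) this, of "(a + h) / 2"] \<open>a < h\<close>
      have "(a + h) / 2 \<in> S" by (simp add: S_def)
      then have "h \<le> (a + h) / 2" unfolding h_def by (rule cInf_lower[OF _ bdd])
      then show False using \<open>a < h\<close> by simp
    qed
  qed (rule above[OF F(1)])
  have "r F' \<longlonglongrightarrow> h" if F': "folner_seq G F'" for F'
  proof (rule order_tendstoI)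
    fix a assume "a < h"
    show "\<forall>\<^sub>F n in sequentially. a < r F' n"
    proof (rule ccontr)
      assume "\<not> ?thesis"
      then have "\<exists>\<^sub>F n in sequentially. r F' n \<le> a" by (simp add: frequently_def not_le)
      \<comment> \<open>Ratios that dip to \<open>a\<close> infinitely often stay there along a
        tempered subsequence \<open>?K\<close>; its Bowen measure then vanishes just above
        \<open>a\<close>, which pushes \<open>r F\<close> below its limit.\<close>
      then have "infinite {n. r F' n \<le> a}" by (simp add: frequently_sequentially infinite_nat_iff_unbounded_le)
      then obtain p :: "nat \<Rightarrow> nat" where p: "strict_mono p" "\<And>n. r F' (p n) \<le> a"
        using infinite_enumerate by blast
      have Fp: "folner_seq G (F' \<circ> p)" by (rule folner_subseq[OF F' p(1)])
      obtain q :: "nat \<Rightarrow> nat" where q: "strict_mono q" "tempered G ((F' \<circ> p) \<circ> q)"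
        by (rule folner_tempered_subseq[OF Fp])
      let ?K = "(F' \<circ> p) \<circ> q"
      have K: "folner_seq G ?K" by (rule folner_subseq[OF Fp q(1)])
      have "r ?K n \<le> a" for n using p(2)[of "q n"] by (simp add: r_def)
      then have "\<exists>\<^sub>F n in sequentially. r ?K n \<le> a" by (intro eventually_frequently) auto
      \<comment> \<open>The gap from \<open>a\<close> to \<open>h\<close> is cut into thirds: one
        for the strict inequality in \<open>lower\<close>, one for the slack in
        \<open>upper\<close>, one for the contradiction with \<open>limF\<close>.\<close>
      from lower[OF K this, of "(2 * a + h) / 3"] \<open>a < h\<close>
      have "bowen_M \<phi> ?K UNIV \<U> ((2 * a + h) / 3) = 0" by simp
      from upper[OF K q(2) this F(1), of "(h - a) / 3"] \<open>a < h\<close>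
      have "\<forall>\<^sub>F n in sequentially. r F n < (2 * a + h) / 3 + (h - a) / 3" by simp
      also have "(2 * a + h) / 3 + (h - a) / 3 = (a + 2 * h) / 3" by (simp add: field_simps)
      finally have "\<forall>\<^sub>F n in sequentially. r F n < (a + 2 * h) / 3" .
      moreover have "\<forall>\<^sub>F n in sequentially. (a + 2 * h) / 3 < r F n"
        using \<open>a < h\<close> by (intro order_tendstoD(1)[OF limF]) simp
      ultimately have "\<forall>\<^sub>F n in sequentially. False" by eventually_elim simp
      then show False by simp
    qed
  qed (rule above[OF F'])
  moreover have "bowen_cover_entropy \<phi> F UNIV \<U> = ereal h"
    unfolding bowen_cover_entropy_def h_def S_def[symmetric] by (rule ereal_Inf'[OF bdd ne, symmetric])
  ultimately show ?thesis using that unfolding r_def by blast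
qed

text \<open>The definite description in \<open>cover_entropy\<close> is proper: one limit serves all
  Foelner sequences, and the existence of \<open>F\<close> makes it unique.\<close>

lemma
  assumes "open_cover \<U>" "folner_seq G F" "tempered G F" "infinite (carrier G)"
  shows bowen_cover_entropy_eq_cover_entropy:
      "bowen_cover_entropy \<phi> F UNIV \<U> = ereal (cover_entropy G \<phi> \<U>)"
    and LIMSEQ_cover_entropy:
      "(\<lambda>n. ln (real (join_number \<U> (F n))) / real (card (F n))) \<longlonglongrightarrow> cover_entropy G \<phi> \<U>"
proof -
  obtain h where h: "bowen_cover_entropy \<phi> F UNIV \<U> = ereal h"
    "\<forall>F'. folner_seq G F' \<longrightarrow>
      (\<lambda>n. ln (real (join_number \<U> (F' n))) / real (card (F' n))) \<longlonglongrightarrow> h"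
    using join_entropy_limit[OF assms] by metis
  have "cover_entropy G \<phi> \<U> = h"
    unfolding cover_entropy_def using h(2) assms(2) LIMSEQ_unique by (intro the_equality) blast+
  with h assms(2) show "bowen_cover_entropy \<phi> F UNIV \<U> = ereal (cover_entropy G \<phi> \<U>)"
    "(\<lambda>n. ln (real (join_number \<U> (F n))) / real (card (F n))) \<longlonglongrightarrow> cover_entropy G \<phi> \<U>"
    by auto
qed

text \<open>One supremum ranges over finite covers, the other over all open covers. They agree
  because a finite subcover has at least the entropy of the whole cover.\<close>

lemma bowen_entropy_eq_top_entropy:
  assumes F: "folner_seq G F" "tempered G F" and inf: "infinite (carrier G)"
  shows "bowen_entropy \<phi> F UNIV = top_entropy G \<phi>"
proof -
  have "bowen_entropy \<phi> F UNIV = (SUP \<U>\<in>{\<U>. finite \<U> \<and> open_cover \<U>}. ereal (cover_entropy G \<phi> \<U>))"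
    unfolding bowen_entropy_def using bowen_cover_entropy_eq_cover_entropy[OF _ F inf] by (intro SUP_cong) auto
  also have "\<dots> = top_entropy G \<phi>"
    unfolding top_entropy_def
  proof (rule antisym)
    show "(SUP \<U>\<in>{\<U>. open_cover \<U>}. ereal (cover_entropy G \<phi> \<U>)) \<le>
        (SUP \<U>\<in>{\<U>. finite \<U> \<and> open_cover \<U>}. ereal (cover_entropy G \<phi> \<U>))"
    proof (rule SUP_mono)
      fix \<U> :: "'x set set" assume "\<U> \<in> {\<U>. open_cover \<U>}"
      then have \<U>: "open_cover \<U>" by simp
      obtain \<V> where V: "\<V> \<subseteq> \<U>" "finite \<V>" "\<Union>\<V> = UNIV"
        by (rule open_cover_finite_subcover[OF \<U>])
      then have oV: "open_cover \<V>" using \<U> by (auto simp: open_cover_def)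
      have "cover_entropy G \<phi> \<U> \<le> cover_entropy G \<phi> \<V>"
      proof (rule LIMSEQ_le[OF LIMSEQ_cover_entropy[OF \<U> F inf] LIMSEQ_cover_entropy[OF oV F inf]],
          intro exI allI impI)
        fix n :: nat assume "1 \<le> n"
        then have "finite (F n)" using F(1) by (simp add: folner_seq_def)
        then show "ln (real (join_number \<U> (F n))) / real (card (F n)) \<le>
            ln (real (join_number \<V> (F n))) / real (card (F n))"
          using cover_number_join_antimono[OF V, of "F n" \<phi>] cover_number_join_bounds(1)[OF V, of "F n" \<phi>]
          by (intro divide_right_mono) (auto simp: ln_mono)
      qed
      then show "\<exists>\<W>\<in>{\<U>. finite \<U> \<and> open_cover \<U>}. ereal (cover_entropy G \<phi> \<U>) \<le> ereal (cover_entropy G \<phi> \<W>)"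
        using V(2) oV by auto
    qed
  qed (rule SUP_subset_mono, auto)
  finally show ?thesis .
qed

end

theorem theorem1p1:
  fixes G :: "('g, 'm) monoid_scheme"
    and \<phi> :: "'g \<Rightarrow> 'x::metric_space \<Rightarrow> 'x"
    and F :: "nat \<Rightarrow> 'g set"
  assumes "compact (UNIV :: 'x set)"
    and "group G" and "countable (carrier G)" and "amenable G"
    and "group_action G (UNIV :: 'x set) \<phi>"
    and "\<And>g. g \<in> carrier G \<Longrightarrow> homeomorphism UNIV UNIV (\<phi> g) (\<phi> (inv\<^bsub>G\<^esub> g))"
    and "folner_seq G F" and "tempered G F"
    and "filterlim (\<lambda>n. real (card (F n)) / ln (real n)) at_top sequentially"
  shows "bowen_entropy \<phi> F UNIV = top_entropy G \<phi>"
proof -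
  interpret group G by fact
  interpret compact_action G \<phi>
  proof unfold_locales
    show "\<phi> (g \<otimes>\<^bsub>G\<^esub> h) x = \<phi> g (\<phi> h x)" if "g \<in> carrier G" "h \<in> carrier G" for g h x
      using group_action.composition_rule[OF assms(5)] that by simp
    show "continuous_on UNIV (\<phi> g)" if "g \<in> carrier G" for g
      using assms(6)[OF that] by (simp add: homeomorphism_def)
  qed fact
  \<comment> \<open>A finite carrier bounds \<open>card (F n)\<close>, and from \<open>n = 3\<close>
    on, where \<open>ln (real n)\<close> is at least 1, it bounds the quotient as well.\<close>
  have "infinite (carrier G)"
  proof
    assume fin: "finite (carrier G)"
    have "\<forall>\<^sub>F n in sequentially. real (card (carrier G)) < real (card (F n)) / ln (real n)"
      using assms(9) by (simp add: filterlim_at_top_dense)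
    then have "\<forall>\<^sub>F n in sequentially. False"
      using eventually_ge_at_top[of 3]
    proof eventually_elim
      case (elim n)
      have "exp 1 \<le> real n" using exp_le elim(2) by linarith
      then have "1 \<le> ln (real n)" using elim(2) by (simp add: ln_ge_iff)
      then have "real (card (F n)) / ln (real n) \<le> real (card (F n)) / 1"
        by (intro divide_left_mono) auto
      moreover have "card (F n) \<le> card (carrier G)"
        using assms(7) elim(2) fin by (intro card_mono) (auto simp: folner_seq_def)
      ultimately show ?case using elim(1) by simp
    qed
    then show False by simp
  qed
  then show ?thesis by (rule bowen_entropy_eq_top_entropy[OF assms(7,8)])
qed

end
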